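(* Let $n$ be a natural number, let $F_n$ be the free mv-algebra on $n$ generators, and let $M_n$ be the mv-algebra of McNaughton functions $[0,1]^n\to[0,1]$. The morphism of mv-algebras $\Gamma(Z_{F_n},E_{F_n})\to \mathrm{Cont}([0,1]^n,[0,1])$ which sends a global section $\sigma$ of the prime spectrum of $F_n$ to the function $$\tau(p)=\lambda\,\sigma\,\kappa(\ell^{-1}(p)),\qquad p\in[0,1]^n,$$ establishes an isomorphism $\Gamma(Z_{F_n},E_{F_n})\xrightarrow{\cong} M_n$ between the mv-algebra of global sections of the prime spectrum of the free algebra and the mv-algebra of McNaughton functions. This isomorphism sends a global section of the form $\widehat g$, $g\in F_n$, to the term function $g$.
   Context: An mv-algebra is a set $A$ with a binary operation $\oplus$, a unary operation $\neg$ and a constant $0$ such that $(A,\oplus,0)$ is a commutative monoid, $\neg\neg x = x$, $x\oplus\neg 0=\neg 0$ and $\neg(\neg x\oplus y)\oplus y=\neg(\neg y\oplus x)\oplus x$. Derived: $1=\neg 0$, $x\ominus y=\neg(\neg x\oplus y)$, $d(x,y)=(x\ominus y)\oplus(y\ominus x)$; $x\le y \iff x\ominus y=0$ is a lattice order. The real unit interval $[0,1]$ is an mv-algebra with $x\oplus y=\min(1,x+y)$, $\neg x=1-x$. An ideal is a subset containing $0$, downward closed and closed under $\oplus$; $A/I$ is the quotient by $x\sim y\iff d(x,y)\in I$, with classes $[x]_I$. An ideal $P$ is prime if $1\notin P$ and for all $x,y$, $x\ominus y\in P$ or $y\ominus x\in P$. Prime spectrum of $A$: $Z_A$ is the set of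 prime ideals with open base $W_a=\{P: a\in P\}$, $a\in A$; $E_A$ is the disjoint union of the $A/P$, $P\in Z_A$, with open base the images $\widehat a(W_b)$, where $\widehat a(P)=[a]_P$. $\Gamma(Z_A,E_A)$ is the mv-algebra (pointwise operations) of continuous global sections of $E_A\to Z_A$, i.e. of functions $\sigma$ with $\sigma(P)\in A/P$ which locally on $Z_A$ are of the form $\widehat s$, $s\in A$. The free algebra $F_n=F[x_1,\dots,x_n]$ is identified with the mv-algebra of term functions on $[0,1]$, i.e. the subalgebra of $\mathrm{Cont}([0,1]^n,[0,1])$ (continuous functions for the usual topologies, pointwise operations) generated by the coordinate projections. For $p\in[0,1]^n$, $\ell^{-1}(p):F_n\to[0,1]$ is the morphism $f\mapsto f(p)$; for a morphism $\chi:A\to[0,1]$, $\kappa(\chi)=\ker\chi=\{a:\chi(a)=0\}$, a maximal ideal. For a maximal ideal $M$ of $A$, $\chi_M:A\to[0,1]$ is the unique morphism with kernel $M$, and $\lambda([a]_M)=\chi_M(a)$ for $[a]_M\in A/M$. A McNaughton function is a continuous function $\tau:[0,1]^n\to[0,1]$ for which there is a finite set $h_1,\dots,h_k$ of linear functions $h_i=s_0+s_1x_1+\dots+s_nx_n$ with integer coefficients such that for each $x\in[0,1]^n$, $\tau(x)=h_i(x)$ for some $i$. They form an mv-subalgebra $M_n$ of $[0,1]^{[0,1]^n}$. *)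

theory Defs
  imports "HOL-Analysis.Analysis" "HOL-Algebra.Congruence"
begin

section \<open>MV-algebras\<close>

record 'a mv_alg = "'a partial_object" +
  mv_oplus :: "'a \<Rightarrow> 'a \<Rightarrow> 'a" (infixl "\<oplus>\<index>" 65)
  mv_neg :: "'a \<Rightarrow> 'a"
  mv_zero :: 'a

locale mv_algebra =
  fixes A :: "('a, 'b) mv_alg_scheme" (structure)
  assumes oplus_closed: "\<lbrakk>x \<in> carrier A; y \<in> carrier A\<rbrakk> \<Longrightarrow> x \<oplus> y \<in> carrier A"
    and neg_closed: "x \<in> carrier A \<Longrightarrow> mv_neg A x \<in> carrier A"
    and zero_closed: "mv_zero A \<in> carrier A"
    and oplus_assoc: "\<lbrakk>x \<in> carrier A; y \<in> carrier A; z \<in> carrier A\<rbrakk>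
          \<Longrightarrow> (x \<oplus> y) \<oplus> z = x \<oplus> (y \<oplus> z)"
    and oplus_comm: "\<lbrakk>x \<in> carrier A; y \<in> carrier A\<rbrakk> \<Longrightarrow> x \<oplus> y = y \<oplus> x"
    and oplus_zero: "x \<in> carrier A \<Longrightarrow> x \<oplus> mv_zero A = x"
    and neg_neg: "x \<in> carrier A \<Longrightarrow> mv_neg A (mv_neg A x) = x"
    and oplus_neg_zero: "x \<in> carrier A \<Longrightarrow> x \<oplus> mv_neg A (mv_zero A) = mv_neg A (mv_zero A)"
    and lukasiewicz: "\<lbrakk>x \<in> carrier A; y \<in> carrier A\<rbrakk>
          \<Longrightarrow> mv_neg A (mv_neg A x \<oplus> y) \<oplus> y = mv_neg A (mv_neg A y \<oplus> x) \<oplus> x"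

definition mv_one :: "('a, 'b) mv_alg_scheme \<Rightarrow> 'a" where
  "mv_one A = mv_neg A (mv_zero A)"

definition mv_ominus :: "('a, 'b) mv_alg_scheme \<Rightarrow> 'a \<Rightarrow> 'a \<Rightarrow> 'a" where
  "mv_ominus A x y = mv_neg A (mv_neg A x \<oplus>\<^bsub>A\<^esub> y)"

definition mv_dist :: "('a, 'b) mv_alg_scheme \<Rightarrow> 'a \<Rightarrow> 'a \<Rightarrow> 'a" where
  "mv_dist A x y = mv_ominus A x y \<oplus>\<^bsub>A\<^esub> mv_ominus A y x"

definition mv_le :: "('a, 'b) mv_alg_scheme \<Rightarrow> 'a \<Rightarrow> 'a \<Rightarrow> bool" where
  "mv_le A x y \<longleftrightarrow> mv_ominus A x y = mv_zero A"

locale mv_morphism = source: mv_algebra A + target: mv_algebra B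
  for A :: "('a, 'b) mv_alg_scheme" and B :: "('c, 'd) mv_alg_scheme" +
  fixes h :: "'a \<Rightarrow> 'c"
  assumes map_closed: "x \<in> carrier A \<Longrightarrow> h x \<in> carrier B"
    and map_oplus: "\<lbrakk>x \<in> carrier A; y \<in> carrier A\<rbrakk> \<Longrightarrow> h (x \<oplus>\<^bsub>A\<^esub> y) = h x \<oplus>\<^bsub>B\<^esub> h y"
    and map_neg: "x \<in> carrier A \<Longrightarrow> h (mv_neg A x) = mv_neg B (h x)"
    and map_zero: "h (mv_zero A) = mv_zero B"

locale mv_isomorphism = mv_morphism +
  assumes bijective: "bij_betw h (carrier A) (carrier B)"

inductive_set mv_generated :: "('a, 'b) mv_alg_scheme \<Rightarrow> 'a set \<Rightarrow> 'a set"
  for A :: "('a, 'b) mv_alg_scheme" and X :: "'a set" where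
  generator: "x \<in> X \<Longrightarrow> x \<in> mv_generated A X"
| zero: "mv_zero A \<in> mv_generated A X"
| neg: "x \<in> mv_generated A X \<Longrightarrow> mv_neg A x \<in> mv_generated A X"
| oplus: "\<lbrakk>x \<in> mv_generated A X; y \<in> mv_generated A X\<rbrakk> \<Longrightarrow> x \<oplus>\<^bsub>A\<^esub> y \<in> mv_generated A X"

definition unit_interval :: "real mv_alg" where
  "unit_interval = \<lparr>carrier = {0..1}, mv_oplus = (\<lambda>x y. min 1 (x + y)),
     mv_neg = (\<lambda>x. 1 - x), mv_zero = 0\<rparr>"


section \<open>Ideals and quotients\<close>

definition mv_ideal :: "('a, 'b) mv_alg_scheme \<Rightarrow> 'a set \<Rightarrow> bool" where
  "mv_ideal A I \<longleftrightarrow> I \<subseteq> carrier A \<and> mv_zero A \<in> I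
     \<and> (\<forall>x\<in>carrier A. \<forall>y\<in>I. mv_le A x y \<longrightarrow> x \<in> I)
     \<and> (\<forall>x\<in>I. \<forall>y\<in>I. x \<oplus>\<^bsub>A\<^esub> y \<in> I)"

definition mv_prime_ideal :: "('a, 'b) mv_alg_scheme \<Rightarrow> 'a set \<Rightarrow> bool" where
  "mv_prime_ideal A P \<longleftrightarrow> mv_ideal A P \<and> mv_one A \<notin> P
     \<and> (\<forall>x\<in>carrier A. \<forall>y\<in>carrier A. mv_ominus A x y \<in> P \<or> mv_ominus A y x \<in> P)"

definition mv_cong :: "('a, 'b) mv_alg_scheme \<Rightarrow> 'a set \<Rightarrow> ('a \<times> 'a) set" where
  "mv_cong A I = {(x, y). x \<in> carrier A \<and> y \<in> carrier A \<and> mv_dist A x y \<in> I}"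

definition mv_class :: "('a, 'b) mv_alg_scheme \<Rightarrow> 'a set \<Rightarrow> 'a \<Rightarrow> 'a set" where
  "mv_class A I a = mv_cong A I `` {a}"

definition mv_quot :: "('a, 'b) mv_alg_scheme \<Rightarrow> 'a set \<Rightarrow> 'a set mv_alg" where
  "mv_quot A I = \<lparr>carrier = carrier A // mv_cong A I,
     mv_oplus = (\<lambda>c c'. \<Union>x\<in>c. \<Union>y\<in>c'. mv_class A I (x \<oplus>\<^bsub>A\<^esub> y)),
     mv_neg = (\<lambda>c. \<Union>x\<in>c. mv_class A I (mv_neg A x)),
     mv_zero = mv_class A I (mv_zero A)\<rparr>"


section \<open>The prime spectrum and its global sections\<close>

definition Spec :: "('a, 'b) mv_alg_scheme \<Rightarrow> 'a set set" where
  "Spec A = {P. mv_prime_ideal A P}"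

definition spec_open :: "('a, 'b) mv_alg_scheme \<Rightarrow> 'a \<Rightarrow> 'a set set" where
  "spec_open A a = {P \<in> Spec A. a \<in> P}"

text \<open>The generating sets below are closed under binary intersection
  (\<open>W\<^sub>a \<inter> W\<^sub>b = W\<close> at \<open>a \<oplus> b\<close>), so they are bases of the topologies they generate.\<close>

definition spec_topology :: "('a, 'b) mv_alg_scheme \<Rightarrow> 'a set topology" where
  "spec_topology A = topology_generated_by (spec_open A ` carrier A)"

text \<open>Points of the disjoint union of the quotients \<open>A/P\<close> are pairs \<open>(P, [a]\<^sub>P)\<close>.\<close>

definition hat :: "('a, 'b) mv_alg_scheme \<Rightarrow> 'a \<Rightarrow> 'a set \<Rightarrow> 'a set \<times> 'a set" where
  "hat A a = (\<lambda>P\<in>Spec A. (P, mv_class A P a))"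

definition etale_topology :: "('a, 'b) mv_alg_scheme \<Rightarrow> ('a set \<times> 'a set) topology" where
  "etale_topology A =
     topology_generated_by {hat A a ` spec_open A b | a b. a \<in> carrier A \<and> b \<in> carrier A}"

definition global_sections ::
    "('a, 'b) mv_alg_scheme \<Rightarrow> ('a set \<Rightarrow> 'a set \<times> 'a set) mv_alg" where
  "global_sections A =
     \<lparr>carrier = {\<sigma> \<in> extensional (Spec A).
        continuous_map (spec_topology A) (etale_topology A) \<sigma> \<and> (\<forall>P\<in>Spec A. fst (\<sigma> P) = P)},
      mv_oplus = (\<lambda>\<sigma> \<rho>. \<lambda>P\<in>Spec A. (P, snd (\<sigma> P) \<oplus>\<^bsub>mv_quot A P\<^esub> snd (\<rho> P))),
      mv_neg = (\<lambda>\<sigma>. \<lambda>P\<in>Spec A. (P, mv_neg (mv_quot A P) (snd (\<sigma> P)))),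
      mv_zero = (\<lambda>P\<in>Spec A. (P, mv_zero (mv_quot A P)))\<rparr>"


section \<open>Morphisms to the unit interval\<close>

definition mv_kernel :: "('a, 'b) mv_alg_scheme \<Rightarrow> ('a \<Rightarrow> real) \<Rightarrow> 'a set" where
  "mv_kernel A \<phi> = {a \<in> carrier A. \<phi> a = 0}"

text \<open>The next two descriptions are only meaningful when \<open>M\<close> is a maximal ideal.\<close>

definition mv_char :: "('a, 'b) mv_alg_scheme \<Rightarrow> 'a set \<Rightarrow> 'a \<Rightarrow> real" where
  "mv_char A M = (THE \<phi>. mv_morphism A unit_interval \<phi> \<and> \<phi> \<in> extensional (carrier A)
     \<and> mv_kernel A \<phi> = M)"

definition mv_lambda :: "('a, 'b) mv_alg_scheme \<Rightarrow> 'a set \<times> 'a set \<Rightarrow> real" where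
  "mv_lambda A = (\<lambda>(M, c). THE r. \<exists>a\<in>carrier A. c = mv_class A M a \<and> r = mv_char A M a)"


section \<open>Algebras of functions on the cube\<close>

text \<open>Points of \<open>[0,1]\<^sup>n\<close> are functions on \<open>{..<n}\<close>, extended by \<open>undefined\<close>; functions on the
  cube are likewise extensional. Coordinates are numbered from 0.\<close>

definition cube :: "nat \<Rightarrow> (nat \<Rightarrow> real) set" where
  "cube n = (\<Pi>\<^sub>E i\<in>{..<n}. {0..1})"

definition cube_topology :: "nat \<Rightarrow> (nat \<Rightarrow> real) topology" where
  "cube_topology n = product_topology (\<lambda>i. top_of_set {0..1}) {..<n}"

definition cube_functions :: "nat \<Rightarrow> ((nat \<Rightarrow> real) \<Rightarrow> real) mv_alg" where
  "cube_functions n =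
     \<lparr>carrier = cube n \<rightarrow>\<^sub>E carrier unit_interval,
      mv_oplus = (\<lambda>f g. \<lambda>p\<in>cube n. f p \<oplus>\<^bsub>unit_interval\<^esub> g p),
      mv_neg = (\<lambda>f. \<lambda>p\<in>cube n. mv_neg unit_interval (f p)),
      mv_zero = (\<lambda>p\<in>cube n. mv_zero unit_interval)\<rparr>"

definition Cont_alg :: "nat \<Rightarrow> ((nat \<Rightarrow> real) \<Rightarrow> real) mv_alg" where
  "Cont_alg n = (cube_functions n)\<lparr>carrier := {f \<in> carrier (cube_functions n).
     continuous_map (cube_topology n) (top_of_set {0..1}) f}\<rparr>"

text \<open>The free algebra on \<open>n\<close> generators, realised as the algebra of term functions on \<open>[0,1]\<close>.\<close>

definition free_alg :: "nat \<Rightarrow> ((nat \<Rightarrow> real) \<Rightarrow> real) mv_alg" where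
  "free_alg n = (Cont_alg n)\<lparr>carrier :=
     mv_generated (Cont_alg n) {(\<lambda>p\<in>cube n. p i) | i. i < n}\<rparr>"

definition integral_affine :: "nat \<Rightarrow> ((nat \<Rightarrow> real) \<Rightarrow> real) set" where
  "integral_affine n =
     {h. \<exists>(c::int) (s::nat \<Rightarrow> int). h = (\<lambda>x. of_int c + (\<Sum>i<n. of_int (s i) * x i))}"

definition McNaughton_alg :: "nat \<Rightarrow> ((nat \<Rightarrow> real) \<Rightarrow> real) mv_alg" where
  "McNaughton_alg n = (cube_functions n)\<lparr>carrier := {\<tau> \<in> carrier (cube_functions n).
     continuous_map (cube_topology n) (top_of_set {0..1}) \<tau> \<and>
     (\<exists>H. finite H \<and> H \<subseteq> integral_affine n \<and> (\<forall>x\<in>cube n. \<exists>h\<in>H. \<tau> x = h x))}\<rparr>"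

definition eval_at :: "nat \<Rightarrow> (nat \<Rightarrow> real) \<Rightarrow> ((nat \<Rightarrow> real) \<Rightarrow> real) \<Rightarrow> real" where
  "eval_at n p = (\<lambda>f\<in>carrier (free_alg n). f p)"

text \<open>\<open>\<tau>(p) = \<lambda> \<sigma> \<kappa>(\<ell>\<^sup>-\<^sup>1(p))\<close>, where \<open>\<ell>\<^sup>-\<^sup>1(p)\<close> is evaluation at \<open>p\<close> and \<open>\<kappa>\<close> takes kernels.\<close>

definition section_function ::
    "nat \<Rightarrow> (((nat \<Rightarrow> real) \<Rightarrow> real) set \<Rightarrow> ((nat \<Rightarrow> real) \<Rightarrow> real) set \<times> ((nat \<Rightarrow> real) \<Rightarrow> real) set)
      \<Rightarrow> (nat \<Rightarrow> real) \<Rightarrow> real" where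
  "section_function n \<sigma> =
     (\<lambda>p\<in>cube n. mv_lambda (free_alg n) (\<sigma> (mv_kernel (free_alg n) (eval_at n p))))"

end

theory Submission
  imports Defs
begin

text \<open>
  Evaluating a global section at the kernels of the evaluations at points of the cube is a
  map into real functions. Three facts make it an isomorphism onto the McNaughton functions.

  \<^item> The spectrum is compact (\<open>Spec_finite_subcover\<close>), since being a prime ideal is a closed
    condition on characteristic functions. So a global section is given by finitely many
    elements \<open>s\<^sub>b\<close> of the free algebra, each one on the primes that contain a given \<open>b\<close>. On
    points this says that the value function agrees with the McNaughton function \<open>s\<^sub>b\<close> on the
    closed zero set of \<open>b\<close>. Finitely many such closed sets cover the cube, and the pasting
    lemma gives a McNaughton function (\<open>section_value_McNaughton\<close>).

  \<^item> Points suffice to separate sections, although a prime need not be the ideal of a point. If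
    \<open>d\<close> vanishes wherever \<open>a\<close> does, then \<open>d \<le> m a\<close> for some \<open>m\<close>, hence \<open>d\<close> lies in every ideal
    that contains \<open>a\<close> (\<open>piecewise_affine_dominated\<close>). This is a Lojasiewicz type
    inequality for piecewise affine functions. On a polyhedron where both functions are
    affine it is an instance of the Farkas lemma.

  \<^item> Every McNaughton function \<open>\<tau>\<close> comes from a section. Let \<open>H\<close> be a finite set of integral
    affine functions among which \<open>\<tau>\<close> chooses at each point. Prescribing, for each pair in \<open>H\<close>, which
    one is the smaller cuts the cube into convex cells, and by continuity \<open>\<tau>\<close> equals a single
    member of \<open>H\<close> on each cell (\<open>piecewise_affine_on_cell\<close>). A prime ideal makes the same
    kind of choice, because it contains the truncation of \<open>g - h\<close> or that of \<open>h - g\<close>; these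
    truncations are elements of the free algebra (\<open>truncation_free\<close>). So the cells
    correspond to basic open sets that cover the spectrum. The truncations of the pieces of
    \<open>\<tau>\<close> agree on the overlaps at points, hence by the inequality above at all primes, and they
    glue (\<open>section_gluing\<close>).
\<close>

section \<open>The Farkas lemma\<close>

text \<open>The dimension of the cube is a number and not a type, so linear forms are taken on the
  functions \<open>'i \<Rightarrow> real\<close>; one equation covers additivity and homogeneity.\<close>

definition linear_form :: "(('i \<Rightarrow> real) \<Rightarrow> real) \<Rightarrow> bool" where
  "linear_form f \<longleftrightarrow> (\<forall>x y c. f (\<lambda>i. x i + c * y i) = f x + c * f y)"

lemma linear_formD: "linear_form f \<Longrightarrow> f (\<lambda>i. x i + c * y i) = f x + c * f y"
  by (simp add: linear_form_def)

lemma linear_form_zero: "linear_form f \<Longrightarrow> f (\<lambda>i. 0) = 0"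
  using linear_formD[of f "\<lambda>i. 0" 1 "\<lambda>i. 0"] by simp

lemma linear_form_scale: "linear_form f \<Longrightarrow> f (\<lambda>i. c * y i) = c * f y"
  using linear_formD[of f "\<lambda>i. 0" c y] by (simp add: linear_form_zero)

text \<open>Bartl's algebraic proof, by induction on the number of forms. If the last form
  \<open>\<alpha> k0\<close> is needed, some \<open>x0\<close> satisfies the other constraints and violates the conclusion;
  then \<open>\<alpha> k0\<close> is negative at \<open>x0\<close> and all forms can be restricted to the hyperplane
  \<open>\<alpha> k0 = 0\<close> by projecting along \<open>x0\<close>.\<close>

lemma farkas:
  fixes \<alpha> :: "'k \<Rightarrow> ('i \<Rightarrow> real) \<Rightarrow> real"
  assumes "finite K" and "\<And>k. k \<in> K \<Longrightarrow> linear_form (\<alpha> k)" and "linear_form \<gamma>"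
    and "\<And>x. (\<And>k. k \<in> K \<Longrightarrow> 0 \<le> \<alpha> k x) \<Longrightarrow> 0 \<le> \<gamma> x"
  shows "\<exists>l. (\<forall>k\<in>K. 0 \<le> l k) \<and> (\<forall>x. \<gamma> x = (\<Sum>k\<in>K. l k * \<alpha> k x))"
  using assms
proof (induction K arbitrary: \<alpha> \<gamma> rule: finite_induct)
  case empty
  have "\<gamma> x = 0" for x
    using empty(3)[of x] empty(3)[of "\<lambda>i. -1 * x i"] linear_form_scale[OF empty(2), of "-1" x]
    by simp
  then show ?case by simp
next
  case (insert k0 K)
  show ?case
  proof (cases "\<forall>x. (\<forall>k\<in>K. 0 \<le> \<alpha> k x) \<longrightarrow> 0 \<le> \<gamma> x")
    case True
    with insert.IH[of \<alpha> \<gamma>] insert.prems obtain l where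
      l: "\<forall>k\<in>K. 0 \<le> l k" "\<forall>x. \<gamma> x = (\<Sum>k\<in>K. l k * \<alpha> k x)" by auto
    have "(\<Sum>k\<in>K. (l(k0 := 0)) k * \<alpha> k x) = (\<Sum>k\<in>K. l k * \<alpha> k x)" for x
      using insert.hyps by (intro sum.cong) auto
    with l insert.hyps show ?thesis by (intro exI[of _ "l(k0 := 0)"]) auto
  next
    case False
    then obtain x1 where x1: "\<forall>k\<in>K. 0 \<le> \<alpha> k x1" "\<gamma> x1 < 0" by (auto simp: not_le)
    have neg: "\<alpha> k0 x1 < 0"
      using insert.prems(3)[of x1] x1 by (force simp: not_le)
    define c where "c = - 1 / \<alpha> k0 x1"
    define x0 where "x0 = (\<lambda>i. c * x1 i)"
    have c: "c > 0" using neg by (simp add: c_def divide_pos_neg)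
    have lin: "linear_form (\<alpha> k)" if "k \<in> insert k0 K" for k using insert.prems(1) that .
    have x0: "\<alpha> k0 x0 = -1" "\<And>k. k \<in> K \<Longrightarrow> 0 \<le> \<alpha> k x0" "\<gamma> x0 < 0"
      using neg c x1 lin linear_form_scale[OF insert.prems(2)]
      by (auto simp: x0_def linear_form_scale c_def[symmetric] mult_pos_neg) (simp add: c_def)
    \<comment> \<open>\<open>\<beta> k\<close> and \<open>\<delta>\<close> are \<open>\<alpha> k\<close> and \<open>\<gamma>\<close> composed with the projection along \<open>x0\<close>.\<close>
    define \<beta> where "\<beta> k x = \<alpha> k x + \<alpha> k x0 * \<alpha> k0 x" for k x
    define \<delta> where "\<delta> x = \<gamma> x + \<gamma> x0 * \<alpha> k0 x" for x
    have shift: "\<beta> k x = \<alpha> k (\<lambda>i. x i + \<alpha> k0 x * x0 i)" if "k \<in> insert k0 K" for k x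
      using linear_formD[OF lin[OF that]] by (simp add: \<beta>_def)
    have shift': "\<delta> x = \<gamma> (\<lambda>i. x i + \<alpha> k0 x * x0 i)" for x
      using linear_formD[OF insert.prems(2)] by (simp add: \<delta>_def)
    have "\<exists>l. (\<forall>k\<in>K. 0 \<le> l k) \<and> (\<forall>x. \<delta> x = (\<Sum>k\<in>K. l k * \<beta> k x))"
    proof (rule insert.IH)
      show "linear_form (\<beta> k)" if "k \<in> K" for k
        using that linear_formD[OF lin, of k] linear_formD[OF lin, of k0]
        by (simp add: linear_form_def \<beta>_def algebra_simps)
      show "linear_form \<delta>"
        using linear_formD[OF insert.prems(2)] linear_formD[OF lin, of k0]
        by (simp add: linear_form_def \<delta>_def algebra_simps)
      show "0 \<le> \<delta> x" if "\<And>k. k \<in> K \<Longrightarrow> 0 \<le> \<beta> k x" for x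
        unfolding shift'
      proof (rule insert.prems(3))
        show "0 \<le> \<alpha> k (\<lambda>i. x i + \<alpha> k0 x * x0 i)" if "k \<in> insert k0 K" for k
          unfolding shift[OF that, symmetric]
          using \<open>\<And>k. k \<in> K \<Longrightarrow> 0 \<le> \<beta> k x\<close> that x0(1) by (auto simp: \<beta>_def)
      qed
    qed
    then obtain l where l: "\<forall>k\<in>K. 0 \<le> l k" "\<And>x. \<delta> x = (\<Sum>k\<in>K. l k * \<beta> k x)" by auto
    define m where "m = (\<Sum>k\<in>K. l k * \<alpha> k x0) - \<gamma> x0"
    have "0 \<le> m"
      using l(1) x0 by (auto simp: m_def intro!: add_increasing sum_nonneg less_imp_le)
        (smt (verit) sum_nonneg mult_nonneg_nonneg)
    moreover have "\<gamma> x = m * \<alpha> k0 x + (\<Sum>k\<in>K. l k * \<alpha> k x)" for x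
      using l(2)[of x]
      by (simp add: \<beta>_def \<delta>_def m_def algebra_simps sum.distrib sum_distrib_left)
    moreover have "(\<Sum>k\<in>K. (l(k0 := m)) k * \<alpha> k x) = (\<Sum>k\<in>K. l k * \<alpha> k x)" for x
      using insert.hyps by (intro sum.cong) auto
    ultimately show ?thesis
      using l(1) insert.hyps by (intro exI[of _ "l(k0 := m)"]) auto
  qed
qed

definition affine_functions :: "nat \<Rightarrow> ((nat \<Rightarrow> real) \<Rightarrow> real) set" where
  "affine_functions n = {h. \<exists>c s. h = (\<lambda>x. c + (\<Sum>i<n. s i * x i))}"

lemma affine_minus:
  assumes "g \<in> affine_functions n" "h \<in> affine_functions n"
  shows "(\<lambda>x. g x - h x) \<in> affine_functions n"
proof -
  from assms obtain c s d t where "g = (\<lambda>x. c + (\<Sum>i<n. s i * x i))"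
    "h = (\<lambda>x. d + (\<Sum>i<n. t i * x i))" by (auto simp: affine_functions_def)
  then have "(\<lambda>x. g x - h x) = (\<lambda>x. (c - d) + (\<Sum>i<n. (s i - t i) * x i))"
    by (simp add: fun_eq_iff sum_subtractf algebra_simps)
  then show ?thesis unfolding affine_functions_def
    by (intro CollectI exI[of _ "c - d"] exI[of _ "\<lambda>i. s i - t i"])
qed

text \<open>The coordinate with index \<open>n\<close> serves as the homogenizing variable. The last conjunct
  says that the form involves only the coordinates up to \<open>n\<close>.\<close>

lemma affine_homogenization:
  assumes "h \<in> affine_functions n"
  shows "\<exists>L. linear_form L \<and> (\<forall>y. y n = 1 \<longrightarrow> L y = h y) \<and> (\<forall>y. (\<forall>i\<le>n. y i = 0) \<longrightarrow> L y = 0)"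
proof -
  from assms obtain c s where h: "h = (\<lambda>x. c + (\<Sum>i<n. s i * x i))"
    by (auto simp: affine_functions_def)
  show ?thesis
    by (rule exI[of _ "\<lambda>y. c * y n + (\<Sum>i<n. s i * y i)"])
      (auto simp: linear_form_def h algebra_simps sum.distrib sum_distrib_left)
qed

text \<open>The Farkas lemma for affine functions, without a case distinction on whether the
  polyhedron is empty or meets the zero set of \<open>a\<close>. After homogenization the implication has
  to be checked also at directions at infinity; there are none, because the cube is bounded.\<close>

lemma affine_farkas_cube:
  assumes G: "finite G" "G \<subseteq> affine_functions n"
    and a: "a \<in> affine_functions n" and d: "d \<in> affine_functions n"
    and impl: "\<And>x. \<lbrakk>x \<in> cube n; \<And>g. g \<in> G \<Longrightarrow> 0 \<le> g x; a x \<le> 0\<rbrakk> \<Longrightarrow> d x \<le> 0"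
  shows "\<exists>m\<ge>0. \<forall>x\<in>cube n. (\<forall>g\<in>G. 0 \<le> g x) \<longrightarrow> d x \<le> m * a x"
proof -
  define hom where "hom h = (SOME L. linear_form L \<and> (\<forall>y. y n = 1 \<longrightarrow> L y = h y)
    \<and> (\<forall>y. (\<forall>i\<le>n. y i = 0) \<longrightarrow> L y = 0))" for h :: "(nat \<Rightarrow> real) \<Rightarrow> real"
  have hom: "linear_form (hom h)" "y n = 1 \<Longrightarrow> hom h y = h y"
    "(\<And>i. i \<le> n \<Longrightarrow> y i = 0) \<Longrightarrow> hom h y = 0" if "h \<in> affine_functions n" for h y
    using someI_ex[OF affine_homogenization[OF that]] unfolding hom_def[symmetric] by simp_all
  have local: "h x = h y" if "h \<in> affine_functions n" and "\<And>i. i < n \<Longrightarrow> x i = y i" for h x y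
    using that by (auto simp: affine_functions_def)
  define k0 where "k0 = (\<lambda>y. - hom a y)"
  define C :: "((nat \<Rightarrow> real) \<Rightarrow> real) set" where
    "C = insert (\<lambda>y. y n) ((\<lambda>i y. y i) ` {..<n} \<union> (\<lambda>i y. y n - y i) ` {..<n})"
  define K where "K = insert k0 (hom ` G \<union> C)"
  have finK: "finite K" using G by (simp add: K_def C_def)
  have lin: "linear_form k" if "k \<in> K" for k
  proof -
    have "linear_form k" if "k \<in> C" for k
      using that by (auto simp: C_def linear_form_def algebra_simps)
    moreover have "linear_form (hom g)" if "g \<in> G" for g using that G hom(1) by auto
    moreover have "linear_form k0"
      using linear_formD[OF hom(1)[OF a]] by (simp add: linear_form_def k0_def)
    ultimately show ?thesis using that by (auto simp: K_def)
  qed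
  have lind: "linear_form (\<lambda>y. - hom d y)"
    using linear_formD[OF hom(1)[OF d]] by (simp add: linear_form_def)
  have cons: "0 \<le> - hom d y" if pos: "\<And>k. k \<in> K \<Longrightarrow> 0 \<le> k y" for y
  proof -
    have yn: "0 \<le> y n" and y0: "\<And>i. i < n \<Longrightarrow> 0 \<le> y i" and y1: "\<And>i. i < n \<Longrightarrow> y i \<le> y n"
      using pos[of "\<lambda>y. y n"] pos[of "\<lambda>y. y i" for i] pos[of "\<lambda>y. y n - y i" for i]
      by (force simp: K_def C_def)+
    show ?thesis
    proof (cases "y n = 0")
      case True
      \<comment> \<open>The homogenized inequalities \<open>0 \<le> x\<^sub>i \<le> 1\<close> of the cube leave only the zero direction.\<close>
      then have "\<And>i. i \<le> n \<Longrightarrow> y i = 0" using y0 y1 by (metis antisym le_neq_implies_less)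
      then show ?thesis using hom(3)[OF d] by simp
    next
      case False
      then have t: "y n > 0" using yn by simp
      define z where "z = (\<lambda>i. inverse (y n) * y i)"
      define x where "x = restrict z {..<n}"
      have x: "x \<in> cube n" using y0 y1 t by (auto simp: x_def z_def cube_def field_simps)
      have val: "h x = inverse (y n) * hom h y" if "h \<in> affine_functions n" for h
      proof -
        have "h x = h z" using that by (rule local) (simp add: x_def)
        also have "\<dots> = hom h z" using hom(2)[OF that, of z] t by (simp add: z_def)
        finally show ?thesis using linear_form_scale[OF hom(1)[OF that]] by (simp add: z_def)
      qed
      have "d x \<le> 0"
      proof (rule impl[OF x])
        show "0 \<le> g x" if "g \<in> G" for g
          using that G pos[of "hom g"] val[of g] t by (auto simp: K_def)
        show "a x \<le> 0" using pos[of k0] val[OF a] t by (auto simp: K_def k0_def mult_nonneg_nonpos)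
      qed
      then show ?thesis using val[OF d] t by (simp add: mult_le_0_iff)
    qed
  qed
  obtain l where l: "\<forall>k\<in>K. 0 \<le> l k" "\<And>y. - hom d y = (\<Sum>k\<in>K. l k * k y)"
    using farkas[of K "\<lambda>k. k" "\<lambda>y. - hom d y", OF finK lin lind cons] by auto
  have "d x \<le> l k0 * a x" if x: "x \<in> cube n" and g: "\<forall>g\<in>G. 0 \<le> g x" for x
  proof -
    define y where "y = x(n := 1)"
    have val: "hom h y = h x" if "h \<in> affine_functions n" for h
      using hom(2)[OF that, of y] local[OF that, of x y] by (simp add: y_def)
    have "0 \<le> k y" if "k \<in> K - {k0}" for k
      using that g x G val by (auto simp: K_def C_def y_def cube_def PiE_def Pi_def)
    then have "0 \<le> (\<Sum>k\<in>K - {k0}. l k * k y)"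
      using l(1) by (intro sum_nonneg mult_nonneg_nonneg) auto
    moreover have "(\<Sum>k\<in>K. l k * k y) = l k0 * k0 y + (\<Sum>k\<in>K - {k0}. l k * k y)"
      using finK by (intro sum.remove) (auto simp: K_def)
    ultimately show ?thesis using l(2)[of y] val[OF a] val[OF d] by (simp add: k0_def)
  qed
  moreover have "0 \<le> l k0" using l(1) by (simp add: K_def)
  ultimately show ?thesis by blast
qed

section \<open>Piecewise affine functions on the cube\<close>

definition segment_point :: "nat \<Rightarrow> (nat \<Rightarrow> real) \<Rightarrow> (nat \<Rightarrow> real) \<Rightarrow> real \<Rightarrow> nat \<Rightarrow> real" where
  "segment_point n p q t = (\<lambda>i\<in>{..<n}. (1 - t) * p i + t * q i)"

lemma cube_coordinate: "x \<in> cube n \<Longrightarrow> i < n \<Longrightarrow> x i \<in> {0..1}"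
  using PiE_mem[of x "{..<n}" "\<lambda>_. {0..1}" i] by (simp add: cube_def)

lemma segment_point_in_cube:
  assumes "p \<in> cube n" "q \<in> cube n" "t \<in> {0..1}"
  shows "segment_point n p q t \<in> cube n"
proof -
  have "(1 - t) * p i + t * q i \<in> {0..1}" if "i < n" for i
  proof -
    have "p i \<in> {0..1}" "q i \<in> {0..1}"
      using cube_coordinate[OF assms(1) that] cube_coordinate[OF assms(2) that] by simp_all
    then show ?thesis
      using assms(3) convex_bound_le[of "p i" 1 "q i" "1 - t" t] by simp
  qed
  then show ?thesis unfolding segment_point_def cube_def by (simp add: restrict_PiE_iff)
qed

lemma segment_point_0: "p \<in> cube n \<Longrightarrow> segment_point n p q 0 = p"
  and segment_point_1: "q \<in> cube n \<Longrightarrow> segment_point n p q 1 = q"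
  by (simp_all add: segment_point_def cube_def PiE_restrict cong: restrict_cong)

lemma affine_segment_point:
  assumes "h \<in> affine_functions n"
  shows "h (segment_point n p q t) = (1 - t) * h p + t * h q"
proof -
  from assms obtain c s where h: "h = (\<lambda>x. c + (\<Sum>i<n. s i * x i))"
    by (auto simp: affine_functions_def)
  have "(\<Sum>i<n. s i * segment_point n p q t i) =
      (1 - t) * (\<Sum>i<n. s i * p i) + t * (\<Sum>i<n. s i * q i)"
    by (simp add: segment_point_def sum_distrib_left distrib_left sum.distrib mult.left_commute)
  then show ?thesis by (simp add: h algebra_simps)
qed

lemma topspace_cube: "topspace (cube_topology n) = cube n"
  by (simp add: cube_topology_def cube_def)

lemma continuous_on_segment:
  assumes f: "continuous_map (cube_topology n) euclideanreal f" and p: "p \<in> cube n" and q: "q \<in> cube n"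
  shows "continuous_on {0..1} (\<lambda>t. f (segment_point n p q t))"
proof -
  have "continuous_map (top_of_set {0..1}) (cube_topology n) (segment_point n p q)"
    unfolding cube_topology_def continuous_map_componentwise
  proof (intro conjI ballI)
    show "segment_point n p q ` topspace (top_of_set {0..1}) \<subseteq> extensional {..<n}"
      by (auto simp: segment_point_def)
    fix i assume i: "i \<in> {..<n}"
    have eq: "(\<lambda>t. segment_point n p q t i) = (\<lambda>t. (1 - t) * p i + t * q i)"
      using i by (simp add: segment_point_def)
    have "(1 - t) * p i + t * q i \<in> {0..1}" if "t \<in> {0..1}" for t
      using cube_coordinate[OF segment_point_in_cube[OF p q that], of i] i fun_cong[OF eq, of t] by simp
    moreover have "continuous_on {0..1} (\<lambda>t. (1 - t) * p i + t * q i)"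
      by (intro continuous_intros)
    ultimately show "continuous_map (top_of_set {0..1}) (top_of_set {0..1}) (\<lambda>t. segment_point n p q t i)"
      unfolding eq continuous_map_in_subtopology by (auto simp: Pi_iff)
  qed
  from continuous_map_compose[OF this f] show ?thesis by (simp add: o_def)
qed

text \<open>The cells of interest have for \<open>R\<close> a relation that compares any two members of a finite
  set of affine functions, so that the difference of two of these functions has constant
  sign on the cell.\<close>

definition cell :: "nat \<Rightarrow> (((nat \<Rightarrow> real) \<Rightarrow> real) \<times> ((nat \<Rightarrow> real) \<Rightarrow> real)) set \<Rightarrow> (nat \<Rightarrow> real) set" where
  "cell n R = {x \<in> cube n. \<forall>(g, h)\<in>R. g x \<le> h x}"

lemma cellD: "x \<in> cell n R \<Longrightarrow> (g, h) \<in> R \<Longrightarrow> g x \<le> h x"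
  by (auto simp: cell_def)

lemma cell_convex:
  assumes R: "R \<subseteq> affine_functions n \<times> affine_functions n" and p: "p \<in> cell n R" and q: "q \<in> cell n R"
    and t: "t \<in> {0..1}"
  shows "segment_point n p q t \<in> cell n R"
  unfolding cell_def
proof (intro CollectI conjI ballI)
  show "segment_point n p q t \<in> cube n"
    using p q t segment_point_in_cube by (auto simp: cell_def)
  fix r assume r: "r \<in> R"
  obtain g h where gh: "r = (g, h)" by (cases r)
  have "g p \<le> h p" "g q \<le> h q" using p q r gh by (auto simp: cell_def)
  then have "(1 - t) * g p + t * g q \<le> (1 - t) * h p + t * h q"
    using t by (intro add_mono mult_left_mono) auto
  then show "case r of (g, h) \<Rightarrow> g (segment_point n p q t) \<le> h (segment_point n p q t)"
    using R r gh affine_segment_point[of g n p q t] affine_segment_point[of h n p q t] by auto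
qed

text \<open>A point in the relative interior of the cell. It is built by adding pairs one at a time:
  at the midpoint of a cell point \<open>p\<close> and a cell point where \<open>g\<close> and \<open>h\<close> differ, \<open>g\<close> and \<open>h\<close>
  differ, and so do all pairs that differ at \<open>p\<close>, since differences do not change sign.\<close>

lemma cell_generic_point:
  assumes H: "finite H" "H \<subseteq> affine_functions n" and R: "R \<subseteq> H \<times> H"
    and tot: "\<And>g h. g \<in> H \<Longrightarrow> h \<in> H \<Longrightarrow> (g, h) \<in> R \<or> (h, g) \<in> R"
    and ne: "cell n R \<noteq> {}"
  shows "\<exists>p\<in>cell n R. \<forall>g\<in>H. \<forall>h\<in>H. g p = h p \<longrightarrow> (\<forall>x\<in>cell n R. g x = h x)"
proof -
  have RA: "R \<subseteq> affine_functions n \<times> affine_functions n" using R H(2) by blast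
  have "\<exists>p\<in>cell n R. \<forall>(g, h)\<in>S. g p = h p \<longrightarrow> (\<forall>x\<in>cell n R. g x = h x)"
    if "finite S" "S \<subseteq> H \<times> H" for S
    using that
  proof (induction S rule: finite_induct)
    case empty
    then show ?case using ne by auto
  next
    case (insert r S)
    then obtain p where p: "p \<in> cell n R"
      "\<forall>(g, h)\<in>S. g p = h p \<longrightarrow> (\<forall>x\<in>cell n R. g x = h x)" by auto
    obtain g h where r: "r = (g, h)" by (cases r)
    show ?case
    proof (cases "g p = h p \<longrightarrow> (\<forall>x\<in>cell n R. g x = h x)")
      case True
      then show ?thesis using p r by auto
    next
      case False
      then obtain x where x: "x \<in> cell n R" "g x \<noteq> h x" and eq: "g p = h p" by auto
      define m where "m = segment_point n p x (1/2)"
      have m: "m \<in> cell n R" unfolding m_def using RA p x by (intro cell_convex) auto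
      have mid: "k m = (k p + k x) / 2" if "k \<in> H" for k
        using affine_segment_point[of k n p x "1/2"] that H by (auto simp: m_def field_simps)
      have "k p = l p" if kl: "k \<in> H" "l \<in> H" "k m = l m" for k l
        using tot[OF kl(1,2)]
      proof
        assume "(k, l) \<in> R"
        from cellD[OF p(1) this] cellD[OF x(1) this] show ?thesis
          using mid[OF kl(1)] mid[OF kl(2)] kl(3) by (simp add: field_simps)
      next
        assume "(l, k) \<in> R"
        from cellD[OF p(1) this] cellD[OF x(1) this] show ?thesis
          using mid[OF kl(1)] mid[OF kl(2)] kl(3) by (simp add: field_simps)
      qed
      then have "\<forall>(k, l)\<in>S. k m = l m \<longrightarrow> (\<forall>x\<in>cell n R. k x = l x)"
        using p(2) insert.prems by blast
      moreover have "g m \<noteq> h m" using mid[of g] mid[of h] insert.prems r eq x by auto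
      ultimately show ?thesis using m r by (intro bexI[of _ m]) auto
    qed
  qed
  from this[of "H \<times> H"] H(1) show ?thesis by simp
qed

text \<open>Start at a generic point \<open>p\<close>, where \<open>\<tau>\<close> equals some \<open>h\<close>, and move towards another point of
  the cell. Every \<open>g\<close> that differs from \<open>h\<close> at \<open>p\<close> stays away from \<open>h\<close> by at least
  \<open>(1 - t) * \<epsilon>\<close> at time \<open>t\<close>, so \<open>\<tau>\<close> cannot leave \<open>h\<close> continuously.\<close>

lemma piecewise_affine_on_cell:
  assumes H: "finite H" "H \<subseteq> affine_functions n" and R: "R \<subseteq> H \<times> H"
    and tot: "\<And>g h. g \<in> H \<Longrightarrow> h \<in> H \<Longrightarrow> (g, h) \<in> R \<or> (h, g) \<in> R"
    and ne: "cell n R \<noteq> {}"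
    and cont: "continuous_map (cube_topology n) euclideanreal \<tau>"
    and pieces: "\<And>x. x \<in> cube n \<Longrightarrow> \<exists>h\<in>H. \<tau> x = h x"
  shows "\<exists>h\<in>H. \<forall>x\<in>cell n R. \<tau> x = h x"
proof -
  obtain p where p: "p \<in> cell n R"
    and generic: "\<forall>g\<in>H. \<forall>h\<in>H. g p = h p \<longrightarrow> (\<forall>x\<in>cell n R. g x = h x)"
    using cell_generic_point[OF H R tot ne] by blast
  have RA: "R \<subseteq> affine_functions n \<times> affine_functions n" using R H(2) by blast
  have pc: "p \<in> cube n" using p by (simp add: cell_def)
  obtain h where h: "h \<in> H" "\<tau> p = h p" using pieces[OF pc] by auto
  have "\<tau> x = h x" if x: "x \<in> cell n R" for x
  proof (rule ccontr)
    assume neq: "\<tau> x \<noteq> h x"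
    have xc: "x \<in> cube n" using x by (simp add: cell_def)
    define f where "f t = \<tau> (segment_point n p x t) - h (segment_point n p x t)" for t
    define D where "D = {\<bar>g p - h p\<bar> | g. g \<in> H \<and> g p \<noteq> h p}"
    define \<epsilon> where "\<epsilon> = Min (insert 1 D)"
    have finD: "finite D" using H(1) by (auto simp: D_def)
    have "\<forall>d\<in>D. 0 < d" by (auto simp: D_def)
    with finD have "\<epsilon> > 0" by (simp add: \<epsilon>_def)
    moreover have "\<epsilon> \<le> \<bar>g p - h p\<bar>" if "g \<in> H" "g p \<noteq> h p" for g
      unfolding \<epsilon>_def using finD that by (intro Min_le) (auto simp: D_def)
    ultimately have eps: "\<epsilon> > 0" "\<And>g. \<lbrakk>g \<in> H; g p \<noteq> h p\<rbrakk> \<Longrightarrow> \<epsilon> \<le> \<bar>g p - h p\<bar>" by auto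
    have gap: "f t = 0 \<or> (1 - t) * \<epsilon> \<le> \<bar>f t\<bar>" if t: "t \<in> {0..1}" for t
    proof -
      have s: "segment_point n p x t \<in> cell n R" by (rule cell_convex[OF RA p x t])
      then have "segment_point n p x t \<in> cube n" by (simp add: cell_def)
      from pieces[OF this] obtain g
        where g: "g \<in> H" "\<tau> (segment_point n p x t) = g (segment_point n p x t)" by blast
      show ?thesis
      proof (cases "g p = h p")
        case True
        then show ?thesis using bspec[OF bspec[OF generic g(1)] h(1)] s g(2) by (simp add: f_def)
      next
        case False
        have f: "f t = (1 - t) * (g p - h p) + t * (g x - h x)"
          using affine_segment_point[of g n p x t] affine_segment_point[of h n p x t] g h H(2)
          by (simp add: f_def subset_iff algebra_simps)
        have "(g p \<le> h p \<and> g x \<le> h x) \<or> (h p \<le> g p \<and> h x \<le> g x)"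
          using tot[OF g(1) h(1)] cellD[OF p] cellD[OF x] by blast
        then have "\<bar>f t\<bar> = \<bar>(1 - t) * (g p - h p)\<bar> + \<bar>t * (g x - h x)\<bar>"
        proof
          assume "g p \<le> h p \<and> g x \<le> h x"
          then have "(1 - t) * (g p - h p) \<le> 0" "t * (g x - h x) \<le> 0"
            using t by (auto simp: mult_nonneg_nonpos)
          then show ?thesis unfolding f by linarith
        next
          assume "h p \<le> g p \<and> h x \<le> g x"
          then have "(1 - t) * (g p - h p) \<ge> 0" "t * (g x - h x) \<ge> 0"
            using t by auto
          then show ?thesis unfolding f by linarith
        qed
        then have "\<bar>f t\<bar> = (1 - t) * \<bar>g p - h p\<bar> + t * \<bar>g x - h x\<bar>"
          using t by (simp add: abs_mult)
        moreover have "(1 - t) * \<epsilon> \<le> (1 - t) * \<bar>g p - h p\<bar>"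
          using eps(2)[OF g(1) False] t by (intro mult_left_mono) auto
        moreover have "0 \<le> t * \<bar>g x - h x\<bar>" using t by auto
        ultimately show ?thesis by linarith
      qed
    qed
    have "continuous_on {0..1} (\<lambda>t. \<tau> (segment_point n p x t))"
      by (rule continuous_on_segment[OF cont pc xc])
    moreover have "continuous_on {0..1} (\<lambda>t. h (segment_point n p x t))"
    proof -
      have "(\<lambda>t. h (segment_point n p x t)) = (\<lambda>t. (1 - t) * h p + t * h x)"
        using affine_segment_point[of h n p x] h(1) H(2) by (simp add: subset_iff)
      then show ?thesis by (simp only:) (intro continuous_intros)
    qed
    ultimately have contf: "continuous_on {0..1} (\<lambda>t. \<bar>f t\<bar> - (1 - t) * \<epsilon> / 2)"
      unfolding f_def by (intro continuous_intros) simp_all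
    have f0: "f 0 = 0" and f1: "f 1 \<noteq> 0"
      unfolding f_def segment_point_0[OF pc] segment_point_1[OF xc] using h(2) neq by simp_all
    \<comment> \<open>The intermediate value \<open>(1 - t) * \<epsilon> / 2\<close> lies strictly inside the gap, except at \<open>t = 1\<close>.\<close>
    have "\<exists>t\<ge>0. t \<le> 1 \<and> \<bar>f t\<bar> - (1 - t) * \<epsilon> / 2 = 0"
      using f0 eps(1)
      by (intro IVT'[where f = "\<lambda>t. \<bar>f t\<bar> - (1 - t) * \<epsilon> / 2"] contf) simp_all
    then obtain t where t: "0 \<le> t" "t \<le> 1" and ft: "\<bar>f t\<bar> = (1 - t) * \<epsilon> / 2" by auto
    have "t \<noteq> 1" using ft f1 by auto
    then have pos: "0 < (1 - t) * \<epsilon>" using t eps(1) by simp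
    have "f t \<noteq> 0" using ft pos by force
    moreover have "f t = 0 \<or> (1 - t) * \<epsilon> \<le> \<bar>f t\<bar>" using t by (intro gap) simp
    ultimately show False using ft pos by linarith
  qed
  then show ?thesis using h(1) by blast
qed

lemma cube_covered_by_cells:
  assumes "x \<in> cube n"
  shows "x \<in> cell n {(g, h) \<in> H \<times> H. g x \<le> h x}"
  using assms by (auto simp: cell_def)

definition piecewise_affine :: "nat \<Rightarrow> ((nat \<Rightarrow> real) \<Rightarrow> real) \<Rightarrow> bool" where
  "piecewise_affine n f \<longleftrightarrow> continuous_map (cube_topology n) euclideanreal f
     \<and> (\<exists>H. finite H \<and> H \<subseteq> affine_functions n \<and> (\<forall>x\<in>cube n. \<exists>h\<in>H. f x = h x))"

text \<open>The inequality that carries vanishing on a zero set over to membership in ideals. The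
  cube is a finite union of cells on which both functions are affine; the Farkas lemma gives
  a constant on each.\<close>

lemma piecewise_affine_dominated:
  assumes a: "piecewise_affine n a" and d: "piecewise_affine n d"
    and pos: "\<And>x. x \<in> cube n \<Longrightarrow> 0 \<le> a x"
    and zeros: "\<And>x. x \<in> cube n \<Longrightarrow> a x = 0 \<Longrightarrow> d x \<le> 0"
  shows "\<exists>m::nat. \<forall>x\<in>cube n. d x \<le> of_nat m * a x"
proof -
  from a d obtain H1 H2 where H1: "finite H1" "H1 \<subseteq> affine_functions n" "\<forall>x\<in>cube n. \<exists>h\<in>H1. a x = h x"
    and H2: "finite H2" "H2 \<subseteq> affine_functions n" "\<forall>x\<in>cube n. \<exists>h\<in>H2. d x = h x"
    unfolding piecewise_affine_def by blast
  define H where "H = H1 \<union> H2"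
  have H: "finite H" "H \<subseteq> affine_functions n" using H1 H2 by (auto simp: H_def)
  define Rs where "Rs = {R. R \<subseteq> H \<times> H \<and> (\<forall>g\<in>H. \<forall>h\<in>H. (g, h) \<in> R \<or> (h, g) \<in> R)}"
  have "finite Rs" using H(1) by (auto simp: Rs_def intro: finite_subset[of _ "Pow (H \<times> H)"])
  have "\<exists>m\<ge>0. \<forall>x\<in>cell n R. d x \<le> m * a x" if R: "R \<in> Rs" for R
  proof (cases "cell n R = {}")
    case False
    have R': "R \<subseteq> H \<times> H" and tot: "\<And>g h. g \<in> H \<Longrightarrow> h \<in> H \<Longrightarrow> (g, h) \<in> R \<or> (h, g) \<in> R"
      using R by (auto simp: Rs_def)
    have "\<exists>h\<in>H. \<forall>x\<in>cell n R. a x = h x"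
    proof (rule piecewise_affine_on_cell[OF H R' tot False])
      show "continuous_map (cube_topology n) euclideanreal a"
        using a by (simp add: piecewise_affine_def)
      show "\<exists>h\<in>H. a x = h x" if "x \<in> cube n" for x using bspec[OF H1(3) that] by (auto simp: H_def)
    qed
    then obtain f where f: "f \<in> H" "\<And>x. x \<in> cell n R \<Longrightarrow> a x = f x" by blast
    have "\<exists>h\<in>H. \<forall>x\<in>cell n R. d x = h x"
    proof (rule piecewise_affine_on_cell[OF H R' tot False])
      show "continuous_map (cube_topology n) euclideanreal d"
        using d by (simp add: piecewise_affine_def)
      show "\<exists>h\<in>H. d x = h x" if "x \<in> cube n" for x using bspec[OF H2(3) that] by (auto simp: H_def)
    qed
    then obtain e where e: "e \<in> H" "\<And>x. x \<in> cell n R \<Longrightarrow> d x = e x" by blast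
    define G where "G = (\<lambda>(g, h) x. h x - g x) ` R"
    have cell: "x \<in> cell n R \<longleftrightarrow> x \<in> cube n \<and> (\<forall>g\<in>G. 0 \<le> g x)" for x
      by (auto simp: cell_def G_def)
    have "finite R" using R' H(1) by (meson finite_SigmaI finite_subset)
    then have "\<exists>m\<ge>0. \<forall>x\<in>cube n. (\<forall>g\<in>G. 0 \<le> g x) \<longrightarrow> e x \<le> m * f x"
    proof (intro affine_farkas_cube)
      show "G \<subseteq> affine_functions n" 
        unfolding G_def using R' H(2) by (force intro: affine_minus)
      show "e x \<le> 0" if x: "x \<in> cube n" "\<And>g. g \<in> G \<Longrightarrow> 0 \<le> g x" "f x \<le> 0" for x
      proof -
        have "x \<in> cell n R" using cell x by auto
        then have "a x = f x" "d x = e x" using e(2) f(2) by blast+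
        then show ?thesis using zeros[OF x(1)] pos[OF x(1)] x(3) by linarith
      qed
    qed (use e(1) f(1) H(2) in \<open>auto simp: G_def\<close>)
    then obtain m where "m \<ge> 0" and m: "\<forall>x\<in>cube n. (\<forall>g\<in>G. 0 \<le> g x) \<longrightarrow> e x \<le> m * f x"
      by blast
    have "d x \<le> m * a x" if "x \<in> cell n R" for x
      using m that cell[of x] e(2)[OF that] f(2)[OF that] by simp
    then show ?thesis using \<open>m \<ge> 0\<close> by blast
  qed auto
  then have "\<forall>R\<in>Rs. \<exists>m. 0 \<le> m \<and> (\<forall>x\<in>cell n R. d x \<le> m * a x)" by blast
  then obtain m where m: "\<forall>R\<in>Rs. 0 \<le> m R \<and> (\<forall>x\<in>cell n R. d x \<le> m R * a x)"
    by (rule bchoice[THEN exE])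
  define N where "N = nat \<lceil>\<Sum>R\<in>Rs. m R\<rceil>"
  have "d x \<le> of_nat N * a x" if x: "x \<in> cube n" for x
  proof -
    define R where "R = {(g, h) \<in> H \<times> H. g x \<le> h x}"
    have R: "R \<in> Rs" by (auto simp: Rs_def R_def)
    have "d x \<le> m R * a x"
      using bspec[OF m R] cube_covered_by_cells[OF x, of H] by (simp add: R_def)
    also have "m R \<le> (\<Sum>R\<in>Rs. m R)" using R \<open>finite Rs\<close> m by (intro member_le_sum) auto
    then have "m R * a x \<le> of_nat N * a x" using pos[OF x] unfolding N_def
      by (intro mult_right_mono) linarith+
    finally show ?thesis .
  qed
  then show ?thesis by blast
qed

section \<open>Generalities on MV-algebras and topologies\<close>

text \<open>An injective map that respects the operations pulls the axioms back. This yields at once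
  that the sections form an MV-algebra and that their evaluation is a morphism.\<close>

lemma mv_morphism_of_injective_map:
  fixes B :: "('a, 'b) mv_alg_scheme" and C :: "('c, 'd) mv_alg_scheme"
  assumes C: "mv_algebra C" and inj: "inj_on h (carrier B)"
    and h: "\<And>x. x \<in> carrier B \<Longrightarrow> h x \<in> carrier C"
    and oplus: "\<And>x y. \<lbrakk>x \<in> carrier B; y \<in> carrier B\<rbrakk> \<Longrightarrow>
      x \<oplus>\<^bsub>B\<^esub> y \<in> carrier B \<and> h (x \<oplus>\<^bsub>B\<^esub> y) = h x \<oplus>\<^bsub>C\<^esub> h y"
    and neg: "\<And>x. x \<in> carrier B \<Longrightarrow> mv_neg B x \<in> carrier B \<and> h (mv_neg B x) = mv_neg C (h x)"
    and zero: "mv_zero B \<in> carrier B \<and> h (mv_zero B) = mv_zero C"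
  shows "mv_morphism B C h"
proof -
  interpret C: mv_algebra C by (rule C)
  have eqI: "x = y" if "x \<in> carrier B" "y \<in> carrier B" "h x = h y" for x y
    using inj that by (auto dest: inj_onD)
  have "mv_algebra B"
  proof
    fix x y z assume x: "x \<in> carrier B" and y: "y \<in> carrier B"
    show "x \<oplus>\<^bsub>B\<^esub> y \<in> carrier B" using oplus x y by simp
    show "x \<oplus>\<^bsub>B\<^esub> y = y \<oplus>\<^bsub>B\<^esub> x"
      using x y by (intro eqI) (simp_all add: oplus h C.oplus_comm)
    show "mv_neg B (mv_neg B x \<oplus>\<^bsub>B\<^esub> y) \<oplus>\<^bsub>B\<^esub> y = mv_neg B (mv_neg B y \<oplus>\<^bsub>B\<^esub> x) \<oplus>\<^bsub>B\<^esub> x"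
      using x y by (intro eqI) (simp_all add: oplus neg h C.lukasiewicz)
    assume z: "z \<in> carrier B"
    show "(x \<oplus>\<^bsub>B\<^esub> y) \<oplus>\<^bsub>B\<^esub> z = x \<oplus>\<^bsub>B\<^esub> (y \<oplus>\<^bsub>B\<^esub> z)"
      using x y z by (intro eqI) (simp_all add: oplus h C.oplus_assoc)
  next
    fix x assume x: "x \<in> carrier B"
    show "mv_neg B x \<in> carrier B" using neg x by simp
    show "x \<oplus>\<^bsub>B\<^esub> mv_zero B = x"
      using x by (intro eqI) (simp_all add: oplus zero h C.oplus_zero)
    show "mv_neg B (mv_neg B x) = x" using x by (intro eqI) (simp_all add: neg h C.neg_neg)
    show "x \<oplus>\<^bsub>B\<^esub> mv_neg B (mv_zero B) = mv_neg B (mv_zero B)"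
      using x by (intro eqI) (simp_all add: oplus neg zero h C.oplus_neg_zero)
  qed (use zero in simp)
  then show ?thesis using C h oplus neg zero
    by (simp add: mv_morphism_def mv_morphism_axioms_def)
qed

lemma unit_interval_simps [simp]:
  "carrier unit_interval = {0..1}" "x \<oplus>\<^bsub>unit_interval\<^esub> y = min 1 (x + y)"
  "mv_neg unit_interval x = 1 - x" "mv_zero unit_interval = 0"
  by (simp_all add: unit_interval_def)

lemma mv_algebra_unit_interval: "mv_algebra unit_interval"
  by unfold_locales auto

text \<open>Doubling from the left (\<open>a \<oplus> a\<close>) and from the right doubles the distance of the two
  values as long as both lie in the same half of the interval; and they do, since the kernel
  determines whether the value exceeds \<open>1/2\<close>.\<close>

lemma unit_morphisms_close:
  assumes \<phi>: "mv_morphism A unit_interval \<phi>" and \<psi>: "mv_morphism A unit_interval \<psi>"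
    and kernel: "mv_kernel A \<phi> = mv_kernel A \<psi>" and "a \<in> carrier A"
  shows "\<bar>\<phi> a - \<psi> a\<bar> \<le> (1/2) ^ k"
proof -
  interpret P: mv_morphism A unit_interval \<phi> by (rule \<phi>)
  interpret Q: mv_morphism A unit_interval \<psi> by (rule \<psi>)
  show ?thesis
    using \<open>a \<in> carrier A\<close>
  proof (induction k arbitrary: a)
    case 0
    then show ?case using P.map_closed[of a] Q.map_closed[of a] by auto
  next
    case (Suc k)
    define u where "u = a \<oplus>\<^bsub>A\<^esub> a"
    define v where "v = mv_neg A (mv_neg A a \<oplus>\<^bsub>A\<^esub> mv_neg A a)"
    have uv: "u \<in> carrier A" "v \<in> carrier A"
      using Suc.prems by (simp_all add: u_def v_def P.source.oplus_closed P.source.neg_closed)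
    have range: "0 \<le> \<phi> a" "\<phi> a \<le> 1" "0 \<le> \<psi> a" "\<psi> a \<le> 1"
      using P.map_closed[of a] Q.map_closed[of a] Suc.prems by auto
    have u: "\<phi> u = min 1 (\<phi> a + \<phi> a)" "\<psi> u = min 1 (\<psi> a + \<psi> a)"
      using Suc.prems by (simp_all add: u_def P.map_oplus Q.map_oplus)
    have v: "\<phi> v = max 0 (2 * \<phi> a - 1)" "\<psi> v = max 0 (2 * \<psi> a - 1)"
      using Suc.prems
      by (simp_all add: v_def P.map_oplus Q.map_oplus P.map_neg Q.map_neg
          P.source.oplus_closed P.source.neg_closed)
    have "\<phi> v = 0 \<longleftrightarrow> \<psi> v = 0" using kernel uv(2) by (auto simp: mv_kernel_def)
    then have "\<phi> a \<le> 1/2 \<longleftrightarrow> \<psi> a \<le> 1/2" by (auto simp: v max_def split: if_splits)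
    moreover have "\<bar>\<phi> u - \<psi> u\<bar> \<le> (1/2) ^ k" "\<bar>\<phi> v - \<psi> v\<bar> \<le> (1/2) ^ k"
      using Suc.IH uv by auto
    ultimately have "2 * \<bar>\<phi> a - \<psi> a\<bar> \<le> (1/2) ^ k"
      using u v range by (auto simp: min_def max_def abs_if split: if_splits)
    then show ?case by simp
  qed
qed

lemma unit_morphism_determined_by_kernel:
  assumes "mv_morphism A unit_interval \<phi>" "mv_morphism A unit_interval \<psi>"
    and "mv_kernel A \<phi> = mv_kernel A \<psi>" and "a \<in> carrier A"
  shows "\<phi> a = \<psi> a"
proof (rule ccontr)
  assume "\<phi> a \<noteq> \<psi> a"
  then obtain k where "(1/2) ^ k < \<bar>\<phi> a - \<psi> a\<bar>"
    using real_arch_pow_inv[of "\<bar>\<phi> a - \<psi> a\<bar>" "1/2"] by auto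
  then show False using unit_morphisms_close[OF assms, of k] by simp
qed

lemma topology_generated_by_base:
  assumes base: "\<And>U V. U \<in> S \<Longrightarrow> V \<in> S \<Longrightarrow> U \<inter> V \<in> S"
  shows "openin (topology_generated_by S) W \<longleftrightarrow> (\<forall>x\<in>W. \<exists>U\<in>S. x \<in> U \<and> U \<subseteq> W)"
proof
  assume "openin (topology_generated_by S) W"
  then have "generate_topology_on S W" by (rule openin_topology_generated_by)
  then show "\<forall>x\<in>W. \<exists>U\<in>S. x \<in> U \<and> U \<subseteq> W"
  proof induction
    case (Int U V)
    show ?case
    proof
      fix x assume "x \<in> U \<inter> V"
      then obtain U' V' where "U' \<in> S" "x \<in> U'" "U' \<subseteq> U" "V' \<in> S" "x \<in> V'" "V' \<subseteq> V"
        using Int.IH by blast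
      then show "\<exists>W\<in>S. x \<in> W \<and> W \<subseteq> U \<inter> V" using base by (intro bexI[of _ "U' \<inter> V'"]) auto
    qed
  next
    case (UN K)
    then show ?case by (meson Union_iff Sup_upper order_trans)
  qed auto
next
  assume "\<forall>x\<in>W. \<exists>U\<in>S. x \<in> U \<and> U \<subseteq> W"
  then have "W = \<Union>{U \<in> S. U \<subseteq> W}" by blast
  moreover have "openin (topology_generated_by S) (\<Union>{U \<in> S. U \<subseteq> W})"
    by (intro openin_Union) (auto intro: topology_generated_by_Basis)
  ultimately show "openin (topology_generated_by S) W" by simp
qed

section \<open>Algebras of functions into the unit interval\<close>

text \<open>For subalgebras of a power of the unit interval all order and distance arguments are
  pointwise. The operations are prescribed on all functions, so that two such algebras on the
  same set have literally the same operations.\<close>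

locale mv_function_algebra =
  fixes X :: "'x set" and A :: "('x \<Rightarrow> real) mv_alg" (structure)
  assumes carrier_functions: "carrier A \<subseteq> X \<rightarrow>\<^sub>E {0..1}"
    and zero_eq: "mv_zero A = (\<lambda>x\<in>X. 0)"
    and oplus_eq: "f \<oplus> g = (\<lambda>x\<in>X. min 1 (f x + g x))"
    and neg_eq: "mv_neg A f = (\<lambda>x\<in>X. 1 - f x)"
    and zero_closed: "mv_zero A \<in> carrier A"
    and oplus_closed: "\<lbrakk>f \<in> carrier A; g \<in> carrier A\<rbrakk> \<Longrightarrow> f \<oplus> g \<in> carrier A"
    and neg_closed: "f \<in> carrier A \<Longrightarrow> mv_neg A f \<in> carrier A"
begin

lemma value_range: "f \<in> carrier A \<Longrightarrow> x \<in> X \<Longrightarrow> 0 \<le> f x \<and> f x \<le> 1"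
  using carrier_functions PiE_mem[of f X "\<lambda>_. {0..1}" x] by auto

lemma eqI: "\<lbrakk>f \<in> carrier A; g \<in> carrier A; \<And>x. x \<in> X \<Longrightarrow> f x = g x\<rbrakk> \<Longrightarrow> f = g"
  using carrier_functions by (intro PiE_ext[of f X "\<lambda>_. {0..1}" g]) auto

lemma mv_algebra: "mv_algebra A"
proof
  fix f g h assume f: "f \<in> carrier A" and g: "g \<in> carrier A"
  show "f \<oplus> g \<in> carrier A" by (rule oplus_closed[OF f g])
  show "f \<oplus> g = g \<oplus> f" by (simp add: oplus_eq add.commute)
  show "mv_neg A (mv_neg A f \<oplus> g) \<oplus> g = mv_neg A (mv_neg A g \<oplus> f) \<oplus> f"
    using value_range[OF f] value_range[OF g]
    by (auto simp: oplus_eq neg_eq min_def intro!: restrict_ext)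
  assume h: "h \<in> carrier A"
  show "(f \<oplus> g) \<oplus> h = f \<oplus> (g \<oplus> h)"
    unfolding oplus_eq
  proof (intro restrict_ext)
    fix x assume x: "x \<in> X"
    show "min 1 ((\<lambda>x\<in>X. min 1 (f x + g x)) x + h x) = min 1 (f x + (\<lambda>x\<in>X. min 1 (g x + h x)) x)"
      using value_range[OF f x] value_range[OF g x] value_range[OF h x] x by (simp add: min_def)
  qed
next
  fix f assume f: "f \<in> carrier A"
  show "mv_neg A f \<in> carrier A" by (rule neg_closed[OF f])
  show "f \<oplus> mv_zero A = f"
    using value_range[OF f] by (intro eqI[OF oplus_closed[OF f zero_closed] f]) (simp add: oplus_eq zero_eq)
  show "mv_neg A (mv_neg A f) = f"
    by (intro eqI[OF neg_closed[OF neg_closed[OF f]] f]) (simp add: neg_eq)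
  show "f \<oplus> mv_neg A (mv_zero A) = mv_neg A (mv_zero A)"
    using value_range[OF f] by (auto simp: oplus_eq neg_eq zero_eq intro!: restrict_ext)
qed (rule zero_closed)

lemma ominus_eq: "f \<in> carrier A \<Longrightarrow> g \<in> carrier A \<Longrightarrow> mv_ominus A f g = (\<lambda>x\<in>X. max 0 (f x - g x))"
  by (auto simp: mv_ominus_def oplus_eq neg_eq intro!: restrict_ext)

lemma ominus_closed: "f \<in> carrier A \<Longrightarrow> g \<in> carrier A \<Longrightarrow> mv_ominus A f g \<in> carrier A"
  by (simp add: mv_ominus_def oplus_closed neg_closed)

lemma dist_closed: "f \<in> carrier A \<Longrightarrow> g \<in> carrier A \<Longrightarrow> mv_dist A f g \<in> carrier A"
  by (simp add: mv_dist_def oplus_closed ominus_closed)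

lemma dist_eq:
  assumes f: "f \<in> carrier A" and g: "g \<in> carrier A"
  shows "mv_dist A f g = (\<lambda>x\<in>X. \<bar>f x - g x\<bar>)"
  using value_range[OF f] value_range[OF g]
  unfolding mv_dist_def ominus_eq[OF f g] ominus_eq[OF g f] oplus_eq
  by (intro restrict_ext) (fastforce simp: min_def max_def abs_if)

lemma oplus_at: "x \<in> X \<Longrightarrow> (f \<oplus> g) x = min 1 (f x + g x)"
  by (simp add: oplus_eq)

lemma dist_at: "\<lbrakk>f \<in> carrier A; g \<in> carrier A; x \<in> X\<rbrakk> \<Longrightarrow> mv_dist A f g x = \<bar>f x - g x\<bar>"
  by (simp add: dist_eq)

lemma one_eq: "mv_one A = (\<lambda>x\<in>X. 1)"
  by (auto simp: mv_one_def neg_eq zero_eq intro!: restrict_ext)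

lemma one_closed: "mv_one A \<in> carrier A"
  by (simp add: mv_one_def neg_closed zero_closed)

lemma le_iff:
  assumes "f \<in> carrier A" and "g \<in> carrier A"
  shows "mv_le A f g \<longleftrightarrow> (\<forall>x\<in>X. f x \<le> g x)"
proof -
  have "mv_le A f g \<longleftrightarrow> (\<forall>x\<in>X. max 0 (f x - g x) = 0)"
    unfolding mv_le_def ominus_eq[OF assms] zero_eq by (auto simp: restrict_def fun_eq_iff)
  moreover have "max 0 (f x - g x) = 0 \<longleftrightarrow> f x \<le> g x" for x by (auto simp: max_def)
  ultimately show ?thesis by simp
qed

text \<open>The function \<open>min 1 (m b)\<close> is the \<open>m\<close>-fold sum of \<open>b\<close>.\<close>

lemma ideal_absorbs:
  assumes I: "mv_ideal A I" and b: "b \<in> I" and f: "f \<in> carrier A"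
    and le: "\<And>x. x \<in> X \<Longrightarrow> f x \<le> of_nat m * b x"
  shows "f \<in> I"
proof -
  have bA: "b \<in> carrier A" using I b by (auto simp: mv_ideal_def)
  have mult: "(\<lambda>x\<in>X. min 1 (of_nat m * b x)) \<in> I" for m
  proof (induction m)
    case 0
    have "(\<lambda>x\<in>X. min 1 (of_nat 0 * b x)) = mv_zero A" by (simp add: zero_eq)
    then show ?case using I by (simp only: mv_ideal_def)
  next
    case (Suc m)
    have "(\<lambda>x\<in>X. min 1 (of_nat (Suc m) * b x)) = (\<lambda>x\<in>X. min 1 (of_nat m * b x)) \<oplus> b"
      unfolding oplus_eq
    proof (intro restrict_ext)
      fix x assume x: "x \<in> X"
      show "min 1 (of_nat (Suc m) * b x) = min 1 ((\<lambda>x\<in>X. min 1 (of_nat m * b x)) x + b x)"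
        using value_range[OF bA x] x by (simp add: min_def algebra_simps)
    qed
    then show ?case using I Suc b by (simp only: mv_ideal_def)
  qed
  then have "(\<lambda>x\<in>X. min 1 (of_nat m * b x)) \<in> carrier A" using I by (auto simp: mv_ideal_def)
  then have "mv_le A f (\<lambda>x\<in>X. min 1 (of_nat m * b x))"
    using le value_range[OF f] by (simp add: le_iff[OF f])
  then show ?thesis using I f mult by (auto simp: mv_ideal_def)
qed

lemma ideal_downward:
  assumes I: "mv_ideal A I" and b: "b \<in> I" and f: "f \<in> carrier A"
    and le: "\<And>x. x \<in> X \<Longrightarrow> f x \<le> b x"
  shows "f \<in> I"
  by (rule ideal_absorbs[OF I b f, of 1]) (use le in simp)

text \<open>The sum of the elements of \<open>S\<close>. Applied to the ideal of a point it also describes the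
  zero set of \<open>b\<close>.\<close>

lemma finite_ideal_generator:
  assumes "finite S" "S \<subseteq> carrier A"
  shows "\<exists>b\<in>carrier A. \<forall>I. mv_ideal A I \<longrightarrow> (b \<in> I \<longleftrightarrow> S \<subseteq> I)"
  using assms
proof (induction S rule: finite_induct)
  case empty
  then show ?case using zero_closed by (auto simp: mv_ideal_def)
next
  case (insert a S)
  then obtain b where b: "b \<in> carrier A" "\<And>I. mv_ideal A I \<Longrightarrow> b \<in> I \<longleftrightarrow> S \<subseteq> I" and a: "a \<in> carrier A"
    by auto
  have "a \<oplus> b \<in> I \<longleftrightarrow> insert a S \<subseteq> I" if I: "mv_ideal A I" for I
  proof
    assume ab: "a \<oplus> b \<in> I"
    have "a \<in> I"
      by (rule ideal_downward[OF I ab a]) (use value_range[OF a] value_range[OF b(1)] in \<open>auto simp: oplus_eq\<close>)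
    moreover have "b \<in> I"
      by (rule ideal_downward[OF I ab b(1)]) (use value_range[OF a] value_range[OF b(1)] in \<open>auto simp: oplus_eq\<close>)
    ultimately show "insert a S \<subseteq> I" using b(2)[OF I] by simp
  next
    assume "insert a S \<subseteq> I"
    then show "a \<oplus> b \<in> I" using b(2)[OF I] I by (simp add: mv_ideal_def)
  qed
  then show ?case using oplus_closed[OF a b(1)] by blast
qed

lemma oplus_in_ideal_iff:
  assumes I: "mv_ideal A I" and a: "a \<in> carrier A" and b: "b \<in> carrier A"
  shows "a \<oplus> b \<in> I \<longleftrightarrow> a \<in> I \<and> b \<in> I"
proof
  assume ab: "a \<oplus> b \<in> I"
  show "a \<in> I \<and> b \<in> I"
    using ideal_downward[OF I ab a] ideal_downward[OF I ab b] value_range[OF a] value_range[OF b]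
    by (simp add: oplus_eq)
qed (use I in \<open>simp add: mv_ideal_def\<close>)

lemma equiv_cong:
  assumes I: "mv_ideal A I"
  shows "equiv (carrier A) (mv_cong A I)"
proof (rule equivI)
  show "mv_cong A I \<subseteq> carrier A \<times> carrier A" by (auto simp: mv_cong_def)
  show "refl_on (carrier A) (mv_cong A I)"
  proof (rule refl_onI)
    fix f assume f: "f \<in> carrier A"
    have "mv_dist A f f = mv_zero A" using f by (simp add: dist_eq zero_eq)
    then show "(f, f) \<in> mv_cong A I" using f I by (simp add: mv_cong_def mv_ideal_def)
  qed
  show "sym (mv_cong A I)"
    by (rule symI) (auto simp: mv_cong_def dist_eq abs_minus_commute)
  show "trans (mv_cong A I)"
  proof (rule transI)
    fix f g h assume "(f, g) \<in> mv_cong A I" "(g, h) \<in> mv_cong A I"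
    then have fgh: "f \<in> carrier A" "g \<in> carrier A" "h \<in> carrier A"
      and d: "mv_dist A f g \<in> I" "mv_dist A g h \<in> I" by (auto simp: mv_cong_def)
    have "mv_dist A f g \<oplus> mv_dist A g h \<in> I" using I d by (simp add: mv_ideal_def)
    then have "mv_dist A f h \<in> I"
    proof (rule ideal_downward[OF I _ dist_closed[OF fgh(1,3)]])
      fix x assume "x \<in> X"
      then show "mv_dist A f h x \<le> (mv_dist A f g \<oplus> mv_dist A g h) x"
        using fgh value_range[of f x] value_range[of h x] by (auto simp: oplus_eq dist_eq)
    qed
    then show "(f, h) \<in> mv_cong A I" using fgh by (simp add: mv_cong_def)
  qed
qed

lemma class_eq_iff:
  assumes "mv_ideal A I" "f \<in> carrier A" "g \<in> carrier A"
  shows "mv_class A I f = mv_class A I g \<longleftrightarrow> mv_dist A f g \<in> I"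
  using eq_equiv_class_iff[OF equiv_cong[OF assms(1)] assms(2,3)] assms(2,3)
  by (simp add: mv_class_def mv_cong_def)

lemma class_memD:
  assumes "mv_ideal A I" "f \<in> carrier A" "g \<in> mv_class A I f"
  shows "g \<in> carrier A" "mv_dist A f g \<in> I"
  using assms(3) by (auto simp: mv_class_def mv_cong_def)

lemma class_self: "mv_ideal A I \<Longrightarrow> f \<in> carrier A \<Longrightarrow> f \<in> mv_class A I f"
  unfolding mv_class_def by (rule equiv_class_self[OF equiv_cong])

lemma quot_oplus:
  assumes I: "mv_ideal A I" and f: "f \<in> carrier A" and g: "g \<in> carrier A"
  shows "mv_class A I f \<oplus>\<^bsub>mv_quot A I\<^esub> mv_class A I g = mv_class A I (f \<oplus> g)"
proof -
  have eq: "mv_class A I (f' \<oplus> g') = mv_class A I (f \<oplus> g)"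
    if "f' \<in> mv_class A I f" "g' \<in> mv_class A I g" for f' g'
  proof -
    note f' = class_memD[OF I f that(1)] and g' = class_memD[OF I g that(2)]
    have "mv_dist A f f' \<oplus> mv_dist A g g' \<in> I" using I f' g' by (simp add: mv_ideal_def)
    then have "mv_dist A (f' \<oplus> g') (f \<oplus> g) \<in> I"
    proof (rule ideal_downward[OF I])
      fix x assume x: "x \<in> X"
      have "\<bar>min 1 (f' x + g' x) - min 1 (f x + g x)\<bar> \<le> min 1 (\<bar>f x - f' x\<bar> + \<bar>g x - g' x\<bar>)"
        using value_range[OF f x] value_range[OF g x] value_range[OF f'(1) x] value_range[OF g'(1) x]
        by linarith
      then show "mv_dist A (f' \<oplus> g') (f \<oplus> g) x \<le> (mv_dist A f f' \<oplus> mv_dist A g g') x"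
        using x f g f'(1) g'(1) by (simp add: dist_at oplus_closed dist_closed oplus_at)
    qed (simp add: f g f' g' oplus_closed dist_closed)
    then show ?thesis by (simp add: class_eq_iff I f g f' g' oplus_closed)
  qed
  have "mv_class A I f \<oplus>\<^bsub>mv_quot A I\<^esub> mv_class A I g =
      (\<Union>f'\<in>mv_class A I f. \<Union>g'\<in>mv_class A I g. mv_class A I (f' \<oplus> g'))"
    by (simp add: mv_quot_def)
  also have "\<dots> = (\<Union>f'\<in>mv_class A I f. \<Union>g'\<in>mv_class A I g. mv_class A I (f \<oplus> g))"
    by (intro SUP_cong refl eq)
  also have "\<dots> = mv_class A I (f \<oplus> g)" using class_self[OF I f] class_self[OF I g] by blast
  finally show ?thesis .
qed

lemma quot_neg:
  assumes I: "mv_ideal A I" and f: "f \<in> carrier A"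
  shows "mv_neg (mv_quot A I) (mv_class A I f) = mv_class A I (mv_neg A f)"
proof -
  have eq: "mv_class A I (mv_neg A f') = mv_class A I (mv_neg A f)" if "f' \<in> mv_class A I f" for f'
  proof -
    note f' = class_memD[OF I f that]
    have "mv_dist A (mv_neg A f') (mv_neg A f) = mv_dist A f f'"
      unfolding dist_eq[OF neg_closed[OF f'(1)] neg_closed[OF f]] dist_eq[OF f f'(1)]
      by (rule restrict_ext) (simp add: neg_eq)
    then show ?thesis using f'(2) by (simp add: class_eq_iff I f f'(1) neg_closed)
  qed
  have "mv_neg (mv_quot A I) (mv_class A I f) = (\<Union>f'\<in>mv_class A I f. mv_class A I (mv_neg A f'))"
    by (simp add: mv_quot_def)
  also have "\<dots> = (\<Union>f'\<in>mv_class A I f. mv_class A I (mv_neg A f))" by (intro SUP_cong refl eq)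
  also have "\<dots> = mv_class A I (mv_neg A f)" using class_self[OF I f] by blast
  finally show ?thesis .
qed

lemma quot_zero: "mv_zero (mv_quot A I) = mv_class A I (mv_zero A)"
  by (simp add: mv_quot_def)

end

section \<open>The spectrum and its sections\<close>

lemma open_coordinate: "open {u. u (a::'a)}"
  and closed_coordinate: "closed {u. u (a::'a)}"
proof -
  have eq: "{u. u (a::'a)} = (\<lambda>u. u a) -` {True}" by auto
  have c: "continuous_on UNIV (\<lambda>u :: 'a \<Rightarrow> bool. u a)" by (rule continuous_on_product_coordinates)
  show "open {u. u (a::'a)}" unfolding eq
    by (rule open_vimage[OF open_discrete c])
  show "closed {u. u (a::'a)}" unfolding eq
    by (rule closed_vimage[OF _ c]) simp
qed

lemma compact_characteristic_functions: "compact (UNIV :: ('a \<Rightarrow> bool) set)"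
proof -
  have "compact_space (product_topology (\<lambda>_ :: 'a. euclidean :: bool topology) UNIV)"
    unfolding compact_space_product_topology
    by (simp add: compact_space_def compactin_euclidean_iff finite_imp_compact)
  then show ?thesis
    by (simp add: euclidean_product_topology compact_space_def compactin_euclidean_iff)
qed

text \<open>Subsets of the algebra form a Cantor cube, which is compact by Tychonoff's theorem. Each
  clause in the definition of a prime ideal involves finitely many coordinates, so the prime
  ideals form a closed subset, and \<open>b \<in> P\<close> is an open condition.\<close>

lemma Spec_finite_subcover:
  assumes cover: "\<And>P. P \<in> Spec A \<Longrightarrow> \<exists>b\<in>B. b \<in> P"
  shows "\<exists>F\<subseteq>B. finite F \<and> (\<forall>P\<in>Spec A. \<exists>b\<in>F. b \<in> P)"
proof -
  define C where "C = {u. mv_prime_ideal A (Collect u)}"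
  have "closed C"
    unfolding C_def mv_prime_ideal_def mv_ideal_def Ball_def subset_iff mem_Collect_eq
    by (intro closed_Collect_conj closed_Collect_all closed_Collect_imp closed_Collect_disj
        closed_Collect_neg open_coordinate closed_coordinate open_Collect_const closed_Collect_const)
  then have compact: "compact C"
    using compact_Int_closed[OF compact_characteristic_functions] by simp
  have sub: "C \<subseteq> (\<Union>b\<in>B. {u. u b})"
  proof
    fix u assume "u \<in> C"
    then show "u \<in> (\<Union>b\<in>B. {u. u b})" using cover[of "Collect u"] by (simp add: C_def Spec_def)
  qed
  obtain F where F: "F \<subseteq> B" "finite F" "C \<subseteq> (\<Union>b\<in>F. {u. u b})"
    by (rule compactE_image[OF compact open_coordinate sub])
  have "\<exists>b\<in>F. b \<in> P" if "P \<in> Spec A" for P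
  proof -
    have "(\<lambda>b. b \<in> P) \<in> C" using that by (simp add: C_def Spec_def)
    then show ?thesis using F(3) by auto
  qed
  then show ?thesis using F by blast
qed

context mv_function_algebra
begin

lemma Spec_ideal: "P \<in> Spec A \<Longrightarrow> mv_ideal A P"
  by (simp add: Spec_def mv_prime_ideal_def)

lemma zero_in_Spec: "P \<in> Spec A \<Longrightarrow> mv_zero A \<in> P"
  using Spec_ideal by (auto simp: mv_ideal_def)

lemma openin_spec_topology:
  "openin (spec_topology A) U \<longleftrightarrow>
    U \<subseteq> Spec A \<and> (\<forall>P\<in>U. \<exists>b\<in>carrier A. b \<in> P \<and> spec_open A b \<subseteq> U)"
proof -
  have "spec_open A a \<inter> spec_open A b \<in> spec_open A ` carrier A"
    if "a \<in> carrier A" "b \<in> carrier A" for a b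
  proof -
    have "spec_open A a \<inter> spec_open A b = spec_open A (a \<oplus> b)"
      using oplus_in_ideal_iff[OF Spec_ideal that] by (auto simp: spec_open_def)
    then show ?thesis using oplus_closed[OF that] by blast
  qed
  then have "openin (spec_topology A) U \<longleftrightarrow> (\<forall>P\<in>U. \<exists>V\<in>spec_open A ` carrier A. P \<in> V \<and> V \<subseteq> U)"
    unfolding spec_topology_def by (intro topology_generated_by_base) blast
  then show ?thesis by (auto simp: spec_open_def)
qed

lemma topspace_spec: "topspace (spec_topology A) = Spec A"
proof -
  have "spec_open A (mv_zero A) = Spec A" using zero_in_Spec by (auto simp: spec_open_def)
  moreover have "spec_open A b \<subseteq> Spec A" for b by (auto simp: spec_open_def)
  ultimately show ?thesis using zero_closed by (fastforce simp: spec_topology_def)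
qed

text \<open>Continuity of a section means being locally of the form \<open>hat A a\<close>. For the converse, two
  such local representatives \<open>a\<close> and \<open>a'\<close> agree exactly at the primes that contain their
  distance, and these form a basic open set.\<close>

lemma section_iff:
  "\<sigma> \<in> carrier (global_sections A) \<longleftrightarrow> \<sigma> \<in> extensional (Spec A) \<and>
    (\<forall>P\<in>Spec A. \<exists>a\<in>carrier A. \<exists>b\<in>carrier A. b \<in> P \<and>
      (\<forall>Q\<in>Spec A. b \<in> Q \<longrightarrow> \<sigma> Q = (Q, mv_class A Q a)))" (is "?L \<longleftrightarrow> ?E \<and> ?R")
proof -
  let ?S = "{hat A a ` spec_open A b |a b. a \<in> carrier A \<and> b \<in> carrier A}"
  have cont: "continuous_map (spec_topology A) (etale_topology A) \<sigma> \<longleftrightarrow>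
      (\<forall>U\<in>?S. openin (spec_topology A) (\<sigma> -` U \<inter> Spec A)) \<and> \<sigma> ` Spec A \<subseteq> \<Union>?S"
    unfolding etale_topology_def continuous_on_generated_topo_iff topspace_spec by blast
  show ?thesis
  proof (intro iffI conjI)
    assume L: ?L
    then show ?E by (simp add: global_sections_def)
    have fst: "fst (\<sigma> P) = P" if "P \<in> Spec A" for P using L that by (simp add: global_sections_def)
    have opens: "openin (spec_topology A) (\<sigma> -` (hat A a ` spec_open A b) \<inter> Spec A)"
      if "a \<in> carrier A" "b \<in> carrier A" for a b
      using L that cont unfolding global_sections_def by auto
    have covered: "\<sigma> ` Spec A \<subseteq> \<Union>?S"
      using L cont unfolding global_sections_def by simp
    show ?R
    proof
      fix P assume P: "P \<in> Spec A"
      then have "\<sigma> P \<in> \<Union>?S" using covered by blast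
      then obtain a c where a: "a \<in> carrier A" and c: "c \<in> carrier A"
        and \<sigma>P: "\<sigma> P \<in> hat A a ` spec_open A c" by blast
      obtain b where b: "b \<in> carrier A" "b \<in> P"
        "spec_open A b \<subseteq> \<sigma> -` (hat A a ` spec_open A c) \<inter> Spec A"
        using opens[OF a c] P \<sigma>P unfolding openin_spec_topology by blast
      have "\<sigma> Q = (Q, mv_class A Q a)" if Q: "Q \<in> Spec A" "b \<in> Q" for Q
      proof -
        have "\<sigma> Q \<in> hat A a ` spec_open A c" using b(3) Q by (auto simp: spec_open_def)
        then obtain Q' where "Q' \<in> Spec A" "\<sigma> Q = (Q', mv_class A Q' a)"
          by (auto simp: spec_open_def hat_def)
        then show ?thesis using fst[OF Q(1)] by simp
      qed
      then show "\<exists>a\<in>carrier A. \<exists>b\<in>carrier A. b \<in> P \<and>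
          (\<forall>Q\<in>Spec A. b \<in> Q \<longrightarrow> \<sigma> Q = (Q, mv_class A Q a))" using a b by blast
    qed
  next
    assume ER: "?E \<and> ?R"
    then have R: ?R by blast
    have "openin (spec_topology A) (\<sigma> -` (hat A a ` spec_open A b) \<inter> Spec A)"
      if a: "a \<in> carrier A" and b: "b \<in> carrier A" for a b
      unfolding openin_spec_topology
    proof (intro conjI ballI)
      fix P assume P: "P \<in> \<sigma> -` (hat A a ` spec_open A b) \<inter> Spec A"
      then obtain a' b' where a': "a' \<in> carrier A" and b': "b' \<in> carrier A" "b' \<in> P"
        and loc: "\<forall>Q\<in>Spec A. b' \<in> Q \<longrightarrow> \<sigma> Q = (Q, mv_class A Q a')" using R by blast
      note I = Spec_ideal
      have "\<sigma> P \<in> hat A a ` spec_open A b" "P \<in> Spec A" using P by auto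
      then have "b \<in> P" "mv_class A P a' = mv_class A P a"
        using loc b' by (auto simp: spec_open_def hat_def)
      then have "mv_dist A a' a \<in> P" using class_eq_iff[OF I a' a] P by simp
      define c where "c = (b' \<oplus> b) \<oplus> mv_dist A a' a"
      have c: "c \<in> carrier A" using a a' b b' by (simp add: c_def oplus_closed dist_closed)
      have c_iff: "c \<in> Q \<longleftrightarrow> b' \<in> Q \<and> b \<in> Q \<and> mv_dist A a' a \<in> Q" if "Q \<in> Spec A" for Q
        using I[OF that] a a' b b' by (simp add: c_def oplus_in_ideal_iff oplus_closed dist_closed)
      have "spec_open A c \<subseteq> \<sigma> -` (hat A a ` spec_open A b) \<inter> Spec A"
      proof
        fix Q assume "Q \<in> spec_open A c"
        then have Q: "Q \<in> Spec A" and q: "b' \<in> Q" "b \<in> Q" "mv_dist A a' a \<in> Q"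
          using c_iff by (auto simp: spec_open_def)
        have "\<sigma> Q = (Q, mv_class A Q a)"
          using loc Q q class_eq_iff[OF I[OF Q] a' a] by simp
        then have "\<sigma> Q = hat A a Q" using Q by (simp add: hat_def)
        then show "Q \<in> \<sigma> -` (hat A a ` spec_open A b) \<inter> Spec A"
          using Q q by (auto simp: spec_open_def)
      qed
      moreover have "c \<in> P" using c_iff P b' \<open>b \<in> P\<close> \<open>mv_dist A a' a \<in> P\<close> by blast
      ultimately show "\<exists>c\<in>carrier A. c \<in> P \<and>
          spec_open A c \<subseteq> \<sigma> -` (hat A a ` spec_open A b) \<inter> Spec A" using c by blast
    qed blast
    moreover have "\<sigma> P \<in> \<Union>?S \<and> fst (\<sigma> P) = P" if P: "P \<in> Spec A" for P
    proof -
      obtain a b where ab: "a \<in> carrier A" "b \<in> carrier A" "b \<in> P" "\<sigma> P = (P, mv_class A P a)"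
        using R P by blast
      then have "\<sigma> P = hat A a P" "P \<in> spec_open A b" using P by (simp_all add: hat_def spec_open_def)
      then have "\<sigma> P \<in> hat A a ` spec_open A b" by blast
      then show ?thesis using ab by auto
    qed
    ultimately show ?L using ER cont unfolding global_sections_def by auto
  qed
qed

lemma section_local:
  assumes "\<sigma> \<in> carrier (global_sections A)" "P \<in> Spec A"
  shows "\<exists>a\<in>carrier A. \<exists>b\<in>carrier A. b \<in> P \<and>
    (\<forall>Q\<in>Spec A. b \<in> Q \<longrightarrow> \<sigma> Q = (Q, mv_class A Q a))"
  using assms unfolding section_iff by blast

lemma section_finite_cover:
  assumes "\<sigma> \<in> carrier (global_sections A)"
  shows "\<exists>F s. finite F \<and> F \<subseteq> carrier A \<and> s ` F \<subseteq> carrier A \<and>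
    (\<forall>P\<in>Spec A. \<exists>b\<in>F. b \<in> P) \<and>
    (\<forall>b\<in>F. \<forall>Q\<in>Spec A. b \<in> Q \<longrightarrow> \<sigma> Q = (Q, mv_class A Q (s b)))"
proof -
  define B where "B = {b \<in> carrier A. \<exists>a\<in>carrier A. \<forall>Q\<in>Spec A. b \<in> Q \<longrightarrow> \<sigma> Q = (Q, mv_class A Q a)}"
  have "\<exists>b\<in>B. b \<in> P" if "P \<in> Spec A" for P
    using assms that unfolding section_iff B_def by blast
  from Spec_finite_subcover[OF this] obtain F where
    F: "F \<subseteq> B" "finite F" "\<forall>P\<in>Spec A. \<exists>b\<in>F. b \<in> P" by blast
  have "\<forall>b\<in>F. \<exists>a. a \<in> carrier A \<and> (\<forall>Q\<in>Spec A. b \<in> Q \<longrightarrow> \<sigma> Q = (Q, mv_class A Q a))"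
    using F(1) by (auto simp: B_def)
  then obtain s where "\<forall>b\<in>F. s b \<in> carrier A \<and> (\<forall>Q\<in>Spec A. b \<in> Q \<longrightarrow> \<sigma> Q = (Q, mv_class A Q (s b)))"
    by (rule bchoice[THEN exE])
  moreover have "F \<subseteq> carrier A" using F(1) by (auto simp: B_def)
  ultimately show ?thesis using F by (intro exI[of _ F] exI[of _ s]) blast
qed

definition point_ideal :: "'x \<Rightarrow> ('x \<Rightarrow> real) set" where
  "point_ideal x = {f \<in> carrier A. f x = 0}"

lemma point_ideal_in_Spec:
  assumes x: "x \<in> X"
  shows "point_ideal x \<in> Spec A"
proof -
  have "mv_ideal A (point_ideal x)"
    unfolding mv_ideal_def
  proof (intro conjI ballI impI)
    show "point_ideal x \<subseteq> carrier A" by (auto simp: point_ideal_def)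
    show "mv_zero A \<in> point_ideal x" using zero_closed x by (simp add: point_ideal_def) (simp add: zero_eq)
    fix f g assume f: "f \<in> carrier A" and g: "g \<in> point_ideal x" and le: "mv_le A f g"
    have "g \<in> carrier A" "g x = 0" using g by (auto simp: point_ideal_def)
    then have "f x \<le> 0" using le x unfolding le_iff[OF f \<open>g \<in> carrier A\<close>] by metis
    then show "f \<in> point_ideal x" using f value_range[OF f x] by (simp add: point_ideal_def)
  next
    fix f g assume "f \<in> point_ideal x" "g \<in> point_ideal x"
    then show "f \<oplus> g \<in> point_ideal x"
      using x by (simp add: point_ideal_def oplus_closed oplus_at)
  qed
  moreover have "mv_one A \<notin> point_ideal x" using x by (simp add: point_ideal_def one_eq)
  moreover have "mv_ominus A f g \<in> point_ideal x \<or> mv_ominus A g f \<in> point_ideal x"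
    if "f \<in> carrier A" "g \<in> carrier A" for f g
  proof -
    have "mv_ominus A f g x = 0 \<or> mv_ominus A g f x = 0"
      unfolding ominus_eq[OF that] ominus_eq[OF that(2,1)] using x by (auto simp: max_def)
    then show ?thesis using ominus_closed[OF that] ominus_closed[OF that(2,1)]
      by (auto simp: point_ideal_def)
  qed
  ultimately show ?thesis by (simp add: Spec_def mv_prime_ideal_def)
qed

text \<open>Evaluation at \<open>x\<close> has kernel \<open>point_ideal x\<close>, and morphisms to the unit interval are
  determined by their kernels.\<close>

lemma mv_char_point_ideal:
  assumes x: "x \<in> X"
  shows "mv_char A (point_ideal x) = (\<lambda>f\<in>carrier A. f x)"
  unfolding mv_char_def
proof (rule the_equality)
  have m: "mv_morphism A unit_interval (\<lambda>f\<in>carrier A. f x)"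
  proof (intro mv_morphism.intro mv_morphism_axioms.intro mv_algebra mv_algebra_unit_interval)
    fix f assume f: "f \<in> carrier A"
    show "(\<lambda>f\<in>carrier A. f x) f \<in> carrier unit_interval" using f value_range[OF f x] by simp
    show "(\<lambda>f\<in>carrier A. f x) (mv_neg A f) = mv_neg unit_interval ((\<lambda>f\<in>carrier A. f x) f)"
      unfolding restrict_apply'[OF f] restrict_apply'[OF neg_closed[OF f]] using x by (simp add: neg_eq)
    fix g assume g: "g \<in> carrier A"
    show "(\<lambda>f\<in>carrier A. f x) (f \<oplus> g) =
        (\<lambda>f\<in>carrier A. f x) f \<oplus>\<^bsub>unit_interval\<^esub> (\<lambda>f\<in>carrier A. f x) g"
      using f g oplus_closed[OF f g] oplus_at[OF x] by simp
  next
    show "(\<lambda>f\<in>carrier A. f x) (mv_zero A) = mv_zero unit_interval"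
      unfolding restrict_apply'[OF zero_closed] using x by (simp add: zero_eq)
  qed
  have k: "mv_kernel A (\<lambda>f\<in>carrier A. f x) = point_ideal x"
    by (auto simp: mv_kernel_def point_ideal_def)
  show "mv_morphism A unit_interval (\<lambda>f\<in>carrier A. f x) \<and> (\<lambda>f\<in>carrier A. f x) \<in> extensional (carrier A)
      \<and> mv_kernel A (\<lambda>f\<in>carrier A. f x) = point_ideal x" using m k by simp
  fix \<phi> assume "mv_morphism A unit_interval \<phi> \<and> \<phi> \<in> extensional (carrier A)
     \<and> mv_kernel A \<phi> = point_ideal x"
  then have \<phi>: "mv_morphism A unit_interval \<phi>" "\<phi> \<in> extensional (carrier A)"
    "mv_kernel A \<phi> = mv_kernel A (\<lambda>f\<in>carrier A. f x)" using k by simp_all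
  show "\<phi> = (\<lambda>f\<in>carrier A. f x)"
    by (rule extensionalityI[OF \<phi>(2) restrict_extensional])
      (rule unit_morphism_determined_by_kernel[OF \<phi>(1) m \<phi>(3)])
qed

definition section_value :: "(('x \<Rightarrow> real) set \<Rightarrow> ('x \<Rightarrow> real) set \<times> ('x \<Rightarrow> real) set) \<Rightarrow> 'x \<Rightarrow> real" where
  "section_value \<sigma> x = mv_lambda A (\<sigma> (point_ideal x))"

lemma mv_lambda_class:
  assumes x: "x \<in> X" and a: "a \<in> carrier A"
  shows "mv_lambda A (point_ideal x, mv_class A (point_ideal x) a) = a x"
proof -
  have I: "mv_ideal A (point_ideal x)" by (rule Spec_ideal[OF point_ideal_in_Spec[OF x]])
  have eq: "a' x = a x"
    if "a' \<in> carrier A" "mv_class A (point_ideal x) a = mv_class A (point_ideal x) a'" for a'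
    using that class_eq_iff[OF I a that(1)] dist_at[OF a that(1) x] by (simp add: point_ideal_def)
  show ?thesis
    unfolding mv_lambda_def prod.case mv_char_point_ideal[OF x]
  proof (rule the_equality)
    show "\<exists>a'\<in>carrier A. mv_class A (point_ideal x) a = mv_class A (point_ideal x) a' \<and>
        a x = (\<lambda>f\<in>carrier A. f x) a'" using a by (intro bexI[of _ a]) simp_all
    fix r assume "\<exists>a'\<in>carrier A. mv_class A (point_ideal x) a = mv_class A (point_ideal x) a' \<and>
        r = (\<lambda>f\<in>carrier A. f x) a'"
    then obtain a' where "a' \<in> carrier A" "mv_class A (point_ideal x) a = mv_class A (point_ideal x) a'"
      "r = a' x" by (metis restrict_apply')
    then show "r = a x" using eq by blast
  qed
qed

lemma section_value_local:
  assumes "x \<in> X" "a \<in> carrier A" "b \<in> carrier A" "b x = 0"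
    and "\<And>Q. \<lbrakk>Q \<in> Spec A; b \<in> Q\<rbrakk> \<Longrightarrow> \<sigma> Q = (Q, mv_class A Q a)"
  shows "section_value \<sigma> x = a x"
proof -
  have "b \<in> point_ideal x" using assms(3,4) by (simp add: point_ideal_def)
  then have "\<sigma> (point_ideal x) = (point_ideal x, mv_class A (point_ideal x) a)"
    using assms(5) point_ideal_in_Spec[OF assms(1)] by blast
  then show ?thesis using mv_lambda_class[OF assms(1,2)] by (simp add: section_value_def)
qed

lemma section_at_point:
  assumes "\<sigma> \<in> carrier (global_sections A)" "x \<in> X"
  obtains a where "a \<in> carrier A" "\<sigma> (point_ideal x) = (point_ideal x, mv_class A (point_ideal x) a)"
    "section_value \<sigma> x = a x"
proof -
  note P = point_ideal_in_Spec[OF assms(2)]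
  obtain a where "a \<in> carrier A"
    "\<sigma> (point_ideal x) = (point_ideal x, mv_class A (point_ideal x) a)"
    using assms(1) P unfolding section_iff by blast
  then show thesis using that mv_lambda_class[OF assms(2)] by (simp add: section_value_def)
qed

lemma section_value_range:
  assumes "\<sigma> \<in> carrier (global_sections A)" "x \<in> X"
  shows "section_value \<sigma> x \<in> {0..1}"
proof -
  obtain a where "a \<in> carrier A" "section_value \<sigma> x = a x" by (rule section_at_point[OF assms])
  then show ?thesis using value_range[of a x] assms(2) by simp
qed

lemma hat_section:
  assumes a: "a \<in> carrier A"
  shows "hat A a \<in> carrier (global_sections A)"
  unfolding section_iff
proof (intro conjI ballI)
  show "hat A a \<in> extensional (Spec A)" by (simp add: hat_def)
  fix P assume "P \<in> Spec A"
  then show "\<exists>a'\<in>carrier A. \<exists>b\<in>carrier A. b \<in> P \<and>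
      (\<forall>Q\<in>Spec A. b \<in> Q \<longrightarrow> hat A a Q = (Q, mv_class A Q a'))"
    using a zero_closed zero_in_Spec by (intro bexI[of _ a] bexI[of _ "mv_zero A"]) (auto simp: hat_def)
qed

lemma section_value_hat: "a \<in> carrier A \<Longrightarrow> x \<in> X \<Longrightarrow> section_value (hat A a) x = a x"
  using mv_lambda_class[of x a] point_ideal_in_Spec[of x] by (simp add: section_value_def hat_def)

lemma section_zero:
  "mv_zero (global_sections A) = hat A (mv_zero A)"
  by (auto simp: global_sections_def hat_def quot_zero)

lemma section_oplus:
  assumes \<sigma>: "\<sigma> \<in> carrier (global_sections A)" and \<rho>: "\<rho> \<in> carrier (global_sections A)"
  shows "\<sigma> \<oplus>\<^bsub>global_sections A\<^esub> \<rho> \<in> carrier (global_sections A)"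
    and "x \<in> X \<Longrightarrow> section_value (\<sigma> \<oplus>\<^bsub>global_sections A\<^esub> \<rho>) x = min 1 (section_value \<sigma> x + section_value \<rho> x)"
proof -
  have sum: "(\<sigma> \<oplus>\<^bsub>global_sections A\<^esub> \<rho>) Q = (Q, mv_class A Q (a \<oplus> a'))"
    if "Q \<in> Spec A" "a \<in> carrier A" "a' \<in> carrier A"
      "\<sigma> Q = (Q, mv_class A Q a)" "\<rho> Q = (Q, mv_class A Q a')" for Q a a'
    using that by (simp add: global_sections_def quot_oplus Spec_ideal)
  show "\<sigma> \<oplus>\<^bsub>global_sections A\<^esub> \<rho> \<in> carrier (global_sections A)"
    unfolding section_iff
  proof (intro conjI ballI)
    show "\<sigma> \<oplus>\<^bsub>global_sections A\<^esub> \<rho> \<in> extensional (Spec A)" by (simp add: global_sections_def)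
    fix P assume P: "P \<in> Spec A"
    obtain a b where a: "a \<in> carrier A" "b \<in> carrier A" "b \<in> P"
      "\<forall>Q\<in>Spec A. b \<in> Q \<longrightarrow> \<sigma> Q = (Q, mv_class A Q a)"
      using section_local[OF \<sigma> P] by blast
    obtain a' b' where a': "a' \<in> carrier A" "b' \<in> carrier A" "b' \<in> P"
      "\<forall>Q\<in>Spec A. b' \<in> Q \<longrightarrow> \<rho> Q = (Q, mv_class A Q a')"
      using section_local[OF \<rho> P] by blast
    have "b \<oplus> b' \<in> P" using a a' P by (simp add: oplus_in_ideal_iff Spec_ideal)
    moreover have "(\<sigma> \<oplus>\<^bsub>global_sections A\<^esub> \<rho>) Q = (Q, mv_class A Q (a \<oplus> a'))"
      if "Q \<in> Spec A" "b \<oplus> b' \<in> Q" for Q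
      using that a a' by (intro sum) (simp_all add: oplus_in_ideal_iff Spec_ideal)
    ultimately show "\<exists>a\<in>carrier A. \<exists>b\<in>carrier A. b \<in> P \<and>
        (\<forall>Q\<in>Spec A. b \<in> Q \<longrightarrow> (\<sigma> \<oplus>\<^bsub>global_sections A\<^esub> \<rho>) Q = (Q, mv_class A Q a))"
      using oplus_closed[OF a(1) a'(1)] oplus_closed[OF a(2) a'(2)] by blast
  qed
  assume x: "x \<in> X"
  obtain a where a: "a \<in> carrier A" "\<sigma> (point_ideal x) = (point_ideal x, mv_class A (point_ideal x) a)"
    "section_value \<sigma> x = a x" by (rule section_at_point[OF \<sigma> x])
  obtain a' where a': "a' \<in> carrier A" "\<rho> (point_ideal x) = (point_ideal x, mv_class A (point_ideal x) a')"
    "section_value \<rho> x = a' x" by (rule section_at_point[OF \<rho> x])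
  have "section_value (\<sigma> \<oplus>\<^bsub>global_sections A\<^esub> \<rho>) x = (a \<oplus> a') x"
    unfolding section_value_def sum[OF point_ideal_in_Spec[OF x] a(1) a'(1) a(2) a'(2)]
    by (rule mv_lambda_class[OF x oplus_closed[OF a(1) a'(1)]])
  then show "section_value (\<sigma> \<oplus>\<^bsub>global_sections A\<^esub> \<rho>) x = min 1 (section_value \<sigma> x + section_value \<rho> x)"
    using a(3) a'(3) oplus_at[OF x] by simp
qed

lemma section_neg:
  assumes \<sigma>: "\<sigma> \<in> carrier (global_sections A)"
  shows "mv_neg (global_sections A) \<sigma> \<in> carrier (global_sections A)"
    and "x \<in> X \<Longrightarrow> section_value (mv_neg (global_sections A) \<sigma>) x = 1 - section_value \<sigma> x"
proof -
  have neg: "mv_neg (global_sections A) \<sigma> Q = (Q, mv_class A Q (mv_neg A a))"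
    if "Q \<in> Spec A" "a \<in> carrier A" "\<sigma> Q = (Q, mv_class A Q a)" for Q a
    using that by (simp add: global_sections_def quot_neg Spec_ideal)
  show "mv_neg (global_sections A) \<sigma> \<in> carrier (global_sections A)"
    unfolding section_iff
  proof (intro conjI ballI)
    show "mv_neg (global_sections A) \<sigma> \<in> extensional (Spec A)" by (simp add: global_sections_def)
    fix P assume P: "P \<in> Spec A"
    obtain a b where a: "a \<in> carrier A" "b \<in> carrier A" "b \<in> P"
      "\<forall>Q\<in>Spec A. b \<in> Q \<longrightarrow> \<sigma> Q = (Q, mv_class A Q a)"
      using section_local[OF \<sigma> P] by blast
    have "mv_neg (global_sections A) \<sigma> Q = (Q, mv_class A Q (mv_neg A a))"
      if "Q \<in> Spec A" "b \<in> Q" for Q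
      by (rule neg[OF that(1) a(1) a(4)[rule_format, OF that]])
    then show "\<exists>a\<in>carrier A. \<exists>b\<in>carrier A. b \<in> P \<and>
        (\<forall>Q\<in>Spec A. b \<in> Q \<longrightarrow> mv_neg (global_sections A) \<sigma> Q = (Q, mv_class A Q a))"
      using neg_closed[OF a(1)] a(2,3) by blast
  qed
  assume x: "x \<in> X"
  obtain a where a: "a \<in> carrier A" "\<sigma> (point_ideal x) = (point_ideal x, mv_class A (point_ideal x) a)"
    "section_value \<sigma> x = a x" by (rule section_at_point[OF \<sigma> x])
  have "section_value (mv_neg (global_sections A) \<sigma>) x = mv_neg A a x"
    unfolding section_value_def neg[OF point_ideal_in_Spec[OF x] a(1,2)]
    by (rule mv_lambda_class[OF x neg_closed[OF a(1)]])
  then show "section_value (mv_neg (global_sections A) \<sigma>) x = 1 - section_value \<sigma> x"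
    using a(3) x by (simp add: neg_eq)
qed

end

text \<open>The extra condition says that every principal ideal is an intersection of ideals of
  points. In the literature such algebras, with maximal ideals in place of points, are called
  strongly semisimple.\<close>

locale strongly_semisimple_function_algebra = mv_function_algebra +
  assumes dominated: "\<lbrakk>a \<in> carrier A; d \<in> carrier A; \<And>x. x \<in> X \<Longrightarrow> a x = 0 \<Longrightarrow> d x = 0\<rbrakk>
    \<Longrightarrow> \<exists>m::nat. \<forall>x\<in>X. d x \<le> of_nat m * a x"
begin

lemma class_eq_if_eq_on_zero_set:
  assumes P: "P \<in> Spec A" and a: "a \<in> carrier A" "a \<in> P" and b: "b \<in> carrier A" "b \<in> P"
    and s: "s \<in> carrier A" and t: "t \<in> carrier A"
    and eq: "\<And>x. \<lbrakk>x \<in> X; a x = 0; b x = 0\<rbrakk> \<Longrightarrow> s x = t x"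
  shows "mv_class A P s = mv_class A P t"
proof -
  have ab: "a \<oplus> b \<in> P" using a b P by (simp add: oplus_in_ideal_iff Spec_ideal)
  have "mv_dist A s t x = 0" if x: "x \<in> X" "(a \<oplus> b) x = 0" for x
  proof -
    have "a x = 0" "b x = 0"
      using x value_range[OF a(1) x(1)] value_range[OF b(1) x(1)] by (auto simp: oplus_at)
    then show ?thesis using eq[OF x(1)] dist_at[OF s t x(1)] by simp
  qed
  then obtain m :: nat where "\<forall>x\<in>X. mv_dist A s t x \<le> of_nat m * (a \<oplus> b) x"
    using dominated[OF oplus_closed[OF a(1) b(1)] dist_closed[OF s t]] by blast
  then have "mv_dist A s t \<in> P"
    by (intro ideal_absorbs[OF Spec_ideal[OF P] ab dist_closed[OF s t]]) blast
  then show ?thesis by (simp add: class_eq_iff[OF Spec_ideal[OF P] s t])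
qed

text \<open>Near any prime both sections are given by elements of the algebra, which agree on a zero
  set by hypothesis and hence at the prime.\<close>

lemma section_value_injective:
  assumes \<sigma>: "\<sigma> \<in> carrier (global_sections A)" and \<rho>: "\<rho> \<in> carrier (global_sections A)"
    and eq: "\<And>x. x \<in> X \<Longrightarrow> section_value \<sigma> x = section_value \<rho> x"
  shows "\<sigma> = \<rho>"
proof (rule extensionalityI[of _ "Spec A"])
  show "\<sigma> \<in> extensional (Spec A)" "\<rho> \<in> extensional (Spec A)"
    using \<sigma> \<rho> by (simp_all add: section_iff)
  fix P assume P: "P \<in> Spec A"
  obtain a b where a: "a \<in> carrier A" "b \<in> carrier A" "b \<in> P"
    "\<forall>Q\<in>Spec A. b \<in> Q \<longrightarrow> \<sigma> Q = (Q, mv_class A Q a)"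
      using section_local[OF \<sigma> P] by blast
  obtain a' b' where a': "a' \<in> carrier A" "b' \<in> carrier A" "b' \<in> P"
    "\<forall>Q\<in>Spec A. b' \<in> Q \<longrightarrow> \<rho> Q = (Q, mv_class A Q a')"
      using section_local[OF \<rho> P] by blast
  have "a x = a' x" if x: "x \<in> X" "b x = 0" "b' x = 0" for x
    using section_value_local[OF x(1) a(1,2) x(2) a(4)[rule_format]]
      section_value_local[OF x(1) a'(1,2) x(3) a'(4)[rule_format]] eq[OF x(1)] by simp
  then have "mv_class A P a = mv_class A P a'"
    by (intro class_eq_if_eq_on_zero_set[OF P a(2,3) a'(2,3) a(1) a'(1)])
  then show "\<sigma> P = \<rho> P" using a(4)[rule_format, OF P a(3)] a'(4)[rule_format, OF P a'(3)] by simp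
qed

text \<open>The pieces are indexed by the pairs in \<open>D\<close>: the element \<open>s\<close> is used at the primes containing
  \<open>b\<close>. They need to be compatible only at points, where all of them equal \<open>\<tau>\<close>.\<close>

lemma section_gluing:
  assumes D: "D \<subseteq> carrier A \<times> carrier A" and cover: "\<And>P. P \<in> Spec A \<Longrightarrow> \<exists>(b, s)\<in>D. b \<in> P"
    and local: "\<And>b s x. \<lbrakk>(b, s) \<in> D; x \<in> X; b x = 0\<rbrakk> \<Longrightarrow> s x = \<tau> x"
  shows "\<exists>\<sigma>\<in>carrier (global_sections A). \<forall>x\<in>X. section_value \<sigma> x = \<tau> x"
proof -
  define c where "c P = (SOME p. p \<in> D \<and> fst p \<in> P)" for P
  define \<sigma> where "\<sigma> = (\<lambda>P\<in>Spec A. (P, mv_class A P (snd (c P))))"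
  have c: "c P \<in> D \<and> fst (c P) \<in> P" if P: "P \<in> Spec A" for P
    unfolding c_def by (rule someI_ex) (use cover[OF P] in force)
  have \<sigma>_local: "\<sigma> Q = (Q, mv_class A Q s)" if "(b, s) \<in> D" "Q \<in> Spec A" "b \<in> Q" for b s Q
  proof -
    obtain b' s' where c': "c Q = (b', s')" by (cases "c Q")
    then have bs': "(b', s') \<in> D" "b' \<in> Q" using c[OF that(2)] by auto
    have "mv_class A Q s' = mv_class A Q s"
    proof (rule class_eq_if_eq_on_zero_set[OF that(2)])
      show "s' x = s x" if "x \<in> X" "b' x = 0" "b x = 0" for x
        using local[OF bs'(1) that(1,2)] local[OF \<open>(b, s) \<in> D\<close> that(1,3)] by simp
    qed (use D bs' that in auto)
    then show ?thesis using that(2) c' by (simp add: \<sigma>_def)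
  qed
  have "\<sigma> \<in> carrier (global_sections A)"
    unfolding section_iff
  proof (intro conjI ballI)
    show "\<sigma> \<in> extensional (Spec A)" by (simp add: \<sigma>_def)
    fix P assume "P \<in> Spec A"
    then obtain b s where "(b, s) \<in> D" "b \<in> P" using cover by blast
    then show "\<exists>a\<in>carrier A. \<exists>b\<in>carrier A. b \<in> P \<and> (\<forall>Q\<in>Spec A. b \<in> Q \<longrightarrow> \<sigma> Q = (Q, mv_class A Q a))"
      using \<sigma>_local D by blast
  qed
  moreover have "section_value \<sigma> x = \<tau> x" if x: "x \<in> X" for x
  proof -
    obtain b s where bs: "(b, s) \<in> D" "b \<in> point_ideal x" using cover[OF point_ideal_in_Spec[OF x]] by blast
    then have "b x = 0" "b \<in> carrier A" "s \<in> carrier A" using D by (auto simp: point_ideal_def)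
    then show ?thesis using section_value_local[OF x _ _ _ \<sigma>_local[OF bs(1)]] local[OF bs(1) x] by simp
  qed
  ultimately show ?thesis by blast
qed

end

section \<open>The algebras of functions on the cube\<close>

lemma mv_function_algebra_cube:
  assumes "S \<subseteq> cube n \<rightarrow>\<^sub>E {0..1}" and "(\<lambda>x\<in>cube n. 0) \<in> S"
    and "\<And>f g. f \<in> S \<Longrightarrow> g \<in> S \<Longrightarrow> (\<lambda>x\<in>cube n. min 1 (f x + g x)) \<in> S"
    and "\<And>f. f \<in> S \<Longrightarrow> (\<lambda>x\<in>cube n. 1 - f x) \<in> S"
  shows "mv_function_algebra (cube n) ((cube_functions n)\<lparr>carrier := S\<rparr>)"
  by unfold_locales (use assms in \<open>simp_all add: cube_functions_def\<close>)

lemma cube_value_range: "f \<in> cube n \<rightarrow>\<^sub>E {0..1} \<Longrightarrow> x \<in> cube n \<Longrightarrow> 0 \<le> f x \<and> f x \<le> (1::real)"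
  using PiE_mem[of f "cube n" "\<lambda>_. {0..1}" x] by simp

lemma carrier_Cont_alg:
  "carrier (Cont_alg n) = {f \<in> cube n \<rightarrow>\<^sub>E {0..1}. continuous_map (cube_topology n) euclideanreal f}"
proof -
  have "f ` cube n \<subseteq> {0..1}" if "f \<in> cube n \<rightarrow>\<^sub>E {0..1::real}" for f
    using cube_value_range[OF that] by auto
  then show ?thesis
    by (auto simp: Cont_alg_def cube_functions_def continuous_map_in_subtopology topspace_cube)
qed

lemma continuous_on_cube_oplus:
  assumes "continuous_map (cube_topology n) euclideanreal f" "continuous_map (cube_topology n) euclideanreal g"
  shows "continuous_map (cube_topology n) euclideanreal (\<lambda>x\<in>cube n. min 1 (f x + g x))"
proof (rule continuous_map_eq)
  show "continuous_map (cube_topology n) euclideanreal (\<lambda>x. min 1 (f x + g x))"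
    using assms by (intro continuous_map_real_min continuous_map_add) auto
qed (simp add: topspace_cube)

lemma continuous_on_cube_neg:
  assumes "continuous_map (cube_topology n) euclideanreal f"
  shows "continuous_map (cube_topology n) euclideanreal (\<lambda>x\<in>cube n. 1 - f x)"
proof (rule continuous_map_eq)
  show "continuous_map (cube_topology n) euclideanreal (\<lambda>x. 1 - f x)"
    using assms by (intro continuous_map_diff) auto
qed (simp add: topspace_cube)

lemma continuous_on_cube_zero:
  "continuous_map (cube_topology n) euclideanreal (\<lambda>x\<in>cube n. 0)"
  by (rule continuous_map_eq[of _ _ "\<lambda>_. 0"]) (simp_all add: topspace_cube)

lemma Cont_function_algebra: "mv_function_algebra (cube n) (Cont_alg n)"
proof -
  have "Cont_alg n = (cube_functions n)\<lparr>carrier := carrier (Cont_alg n)\<rparr>"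
    by (simp add: Cont_alg_def)
  moreover have "mv_function_algebra (cube n) ((cube_functions n)\<lparr>carrier := carrier (Cont_alg n)\<rparr>)"
    unfolding carrier_Cont_alg
  proof (rule mv_function_algebra_cube)
    let ?S = "{f \<in> cube n \<rightarrow>\<^sub>E {0..1}. continuous_map (cube_topology n) euclideanreal f}"
    show "?S \<subseteq> cube n \<rightarrow>\<^sub>E {0..1}" by blast
    show "(\<lambda>x\<in>cube n. 0) \<in> ?S" by (simp add: continuous_on_cube_zero restrict_PiE_iff)
    fix f assume f: "f \<in> ?S"
    then have f_range: "\<forall>x\<in>cube n. 0 \<le> f x \<and> f x \<le> 1" using cube_value_range by blast
    then show "(\<lambda>x\<in>cube n. 1 - f x) \<in> ?S"
      using f by (simp add: continuous_on_cube_neg restrict_PiE_iff Pi_iff)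
    fix g assume g: "g \<in> ?S"
    then have "\<forall>x\<in>cube n. 0 \<le> g x \<and> g x \<le> 1" using cube_value_range by blast
    then show "(\<lambda>x\<in>cube n. min 1 (f x + g x)) \<in> ?S"
      using f g f_range by (simp add: continuous_on_cube_oplus restrict_PiE_iff Pi_iff)
  qed
  ultimately show ?thesis by simp
qed

lemma integral_affine_const: "(\<lambda>x. of_int c) \<in> integral_affine n"
  unfolding integral_affine_def by (intro CollectI exI[of _ c] exI[of _ "\<lambda>_. 0"]) simp

lemma integral_affine_diff:
  assumes "g \<in> integral_affine n" "h \<in> integral_affine n"
  shows "(\<lambda>x. g x - h x) \<in> integral_affine n"
proof -
  from assms obtain c s d t where "g = (\<lambda>x. of_int c + (\<Sum>i<n. of_int (s i) * x i))"
    "h = (\<lambda>x. of_int d + (\<Sum>i<n. of_int (t i) * x i))" by (auto simp: integral_affine_def)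
  then have "(\<lambda>x. g x - h x) = (\<lambda>x. of_int (c - d) + (\<Sum>i<n. of_int (s i - t i) * x i))"
    by (simp add: fun_eq_iff sum_subtractf algebra_simps)
  then show ?thesis unfolding integral_affine_def
    by (intro CollectI exI[of _ "c - d"] exI[of _ "\<lambda>i. s i - t i"])
qed

lemma integral_affine_add:
  assumes "g \<in> integral_affine n" "h \<in> integral_affine n"
  shows "(\<lambda>x. g x + h x) \<in> integral_affine n"
  using integral_affine_diff[OF assms(1) integral_affine_diff[OF integral_affine_const[of 0] assms(2)]]
  by simp

lemma integral_affine_coordinate: "i < n \<Longrightarrow> (\<lambda>x. x i) \<in> integral_affine n"
  unfolding integral_affine_def
  by (intro CollectI exI[of _ 0] exI[of _ "\<lambda>j. if j = i then 1 else 0"])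
    (simp add: if_distrib[of of_int] if_distrib[of "\<lambda>u. u * _"] cong: if_cong)

lemma integral_affine_subset: "integral_affine n \<subseteq> affine_functions n"
  by (force simp: integral_affine_def affine_functions_def)

definition piecewise_integral :: "nat \<Rightarrow> ((nat \<Rightarrow> real) \<Rightarrow> real) \<Rightarrow> bool" where
  "piecewise_integral n f \<longleftrightarrow> (\<exists>H. finite H \<and> H \<subseteq> integral_affine n \<and> (\<forall>x\<in>cube n. \<exists>h\<in>H. f x = h x))"

lemma carrier_McNaughton_alg:
  "carrier (McNaughton_alg n) = {f \<in> carrier (Cont_alg n). piecewise_integral n f}"
  by (auto simp: McNaughton_alg_def Cont_alg_def piecewise_integral_def)

lemma piecewise_integral_oplus:
  assumes "piecewise_integral n f" "piecewise_integral n g"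
  shows "piecewise_integral n (\<lambda>x\<in>cube n. min 1 (f x + g x))"
proof -
  from assms obtain H K where H: "finite H" "H \<subseteq> integral_affine n" "\<forall>x\<in>cube n. \<exists>h\<in>H. f x = h x"
    and K: "finite K" "K \<subseteq> integral_affine n" "\<forall>x\<in>cube n. \<exists>k\<in>K. g x = k x"
    unfolding piecewise_integral_def by blast
  define M where "M = (\<lambda>p x. fst p x + snd p x) ` (H \<times> K)"
  have "finite (insert (\<lambda>_. 1) M)" using H(1) K(1) by (simp add: M_def)
  moreover have "insert (\<lambda>_. 1) M \<subseteq> integral_affine n"
  proof (intro insert_subsetI)
    show "(\<lambda>_. 1) \<in> integral_affine n" using integral_affine_const[of 1 n] by simp
    show "M \<subseteq> integral_affine n"
      unfolding M_def using H(2) K(2) by (intro image_subsetI integral_affine_add) auto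
  qed
  moreover have "\<exists>l\<in>insert (\<lambda>_. 1) M. (\<lambda>x\<in>cube n. min 1 (f x + g x)) x = l x" if x: "x \<in> cube n" for x
  proof (cases "f x + g x \<le> 1")
    case True
    obtain h where h: "h \<in> H" "f x = h x" using bspec[OF H(3) x] by blast
    obtain k where k: "k \<in> K" "g x = k x" using bspec[OF K(3) x] by blast
    have "(\<lambda>x. fst (h, k) x + snd (h, k) x) \<in> M"
      unfolding M_def using h(1) k(1) by (intro imageI) simp
    moreover have "(\<lambda>x\<in>cube n. min 1 (f x + g x)) x = (\<lambda>x. fst (h, k) x + snd (h, k) x) x"
      using True x h(2) k(2) by simp
    ultimately show ?thesis by (intro bexI insertI2)
  next
    case False
    then have "(\<lambda>x\<in>cube n. min 1 (f x + g x)) x = (\<lambda>_. 1) x" using x by simp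
    then show ?thesis by (intro bexI[of _ "\<lambda>_. 1"]) simp_all
  qed
  ultimately show ?thesis unfolding piecewise_integral_def by blast
qed

lemma piecewise_integral_neg:
  assumes "piecewise_integral n f"
  shows "piecewise_integral n (\<lambda>x\<in>cube n. 1 - f x)"
proof -
  from assms obtain H where H: "finite H" "H \<subseteq> integral_affine n" "\<forall>x\<in>cube n. \<exists>h\<in>H. f x = h x"
    unfolding piecewise_integral_def by blast
  define L where "L = (\<lambda>h x. 1 - h x) ` H"
  have "L \<subseteq> integral_affine n"
    unfolding L_def using integral_affine_diff[OF integral_affine_const[of 1]] H(2) by auto
  moreover have "\<exists>l\<in>L. (\<lambda>x\<in>cube n. 1 - f x) x = l x" if x: "x \<in> cube n" for x
  proof -
    obtain h where "h \<in> H" "f x = h x" using bspec[OF H(3) x] by blast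
    then show ?thesis using x unfolding L_def by (intro bexI[of _ "\<lambda>x. 1 - h x"]) simp_all
  qed
  moreover have "finite L" using H(1) by (simp add: L_def)
  ultimately show ?thesis unfolding piecewise_integral_def by blast
qed

lemma piecewise_integral_restrict:
  "h \<in> integral_affine n \<Longrightarrow> piecewise_integral n (\<lambda>x\<in>cube n. h x)"
  unfolding piecewise_integral_def by (intro exI[of _ "{h}"]) simp

lemma McNaughton_function_algebra: "mv_function_algebra (cube n) (McNaughton_alg n)"
proof -
  interpret C: mv_function_algebra "cube n" "Cont_alg n" by (rule Cont_function_algebra)
  have "McNaughton_alg n = (cube_functions n)\<lparr>carrier := carrier (McNaughton_alg n)\<rparr>"
    by (simp add: McNaughton_alg_def)
  moreover have "mv_function_algebra (cube n) ((cube_functions n)\<lparr>carrier := carrier (McNaughton_alg n)\<rparr>)"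
    unfolding carrier_McNaughton_alg
  proof (rule mv_function_algebra_cube)
    show "{f \<in> carrier (Cont_alg n). piecewise_integral n f} \<subseteq> cube n \<rightarrow>\<^sub>E {0..1}"
      using C.carrier_functions by blast
    show "(\<lambda>x\<in>cube n. 0) \<in> {f \<in> carrier (Cont_alg n). piecewise_integral n f}"
      using C.zero_closed piecewise_integral_restrict[OF integral_affine_const[of 0]]
      by (simp add: C.zero_eq)
  next
    fix f g assume "f \<in> {f \<in> carrier (Cont_alg n). piecewise_integral n f}"
      "g \<in> {f \<in> carrier (Cont_alg n). piecewise_integral n f}"
    then show "(\<lambda>x\<in>cube n. min 1 (f x + g x)) \<in> {f \<in> carrier (Cont_alg n). piecewise_integral n f}"
      using C.oplus_closed[of f g] piecewise_integral_oplus[of n f g] by (simp add: C.oplus_eq)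
  next
    fix f assume "f \<in> {f \<in> carrier (Cont_alg n). piecewise_integral n f}"
    then show "(\<lambda>x\<in>cube n. 1 - f x) \<in> {f \<in> carrier (Cont_alg n). piecewise_integral n f}"
      using C.neg_closed[of f] piecewise_integral_neg[of n f] by (simp add: C.neg_eq)
  qed
  ultimately show ?thesis by simp
qed

lemma coordinate_McNaughton:
  assumes i: "i < n"
  shows "(\<lambda>x\<in>cube n. x i) \<in> carrier (McNaughton_alg n)"
proof -
  have "continuous_map (cube_topology n) (top_of_set {0..1}) (\<lambda>x. x i)"
    unfolding cube_topology_def using i by (intro continuous_map_product_projection) simp
  then have "continuous_map (cube_topology n) euclideanreal (\<lambda>x. x i)"
    by (simp add: continuous_map_in_subtopology)
  then have "continuous_map (cube_topology n) euclideanreal (\<lambda>x\<in>cube n. x i)"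
    by (rule continuous_map_eq) (simp add: topspace_cube)
  moreover have "(\<lambda>x\<in>cube n. x i) \<in> cube n \<rightarrow>\<^sub>E {0..1}"
    using cube_coordinate[OF _ i] by (simp add: restrict_PiE_iff)
  ultimately show ?thesis
    using piecewise_integral_restrict[OF integral_affine_coordinate[OF i]]
    by (simp add: carrier_McNaughton_alg carrier_Cont_alg)
qed

lemma carrier_free_alg:
  "carrier (free_alg n) = mv_generated (Cont_alg n) {(\<lambda>p\<in>cube n. p i) | i. i < n}"
  by (simp add: free_alg_def)

lemma free_subset_McNaughton: "carrier (free_alg n) \<subseteq> carrier (McNaughton_alg n)"
proof
  interpret C: mv_function_algebra "cube n" "Cont_alg n" by (rule Cont_function_algebra)
  interpret M: mv_function_algebra "cube n" "McNaughton_alg n" by (rule McNaughton_function_algebra)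
  fix f assume "f \<in> carrier (free_alg n)"
  then have "f \<in> mv_generated (Cont_alg n) {(\<lambda>p\<in>cube n. p i) | i. i < n}"
    by (simp only: carrier_free_alg)
  then show "f \<in> carrier (McNaughton_alg n)"
  proof induction
    case (generator f)
    then show ?case using coordinate_McNaughton by blast
  next
    case zero
    show ?case using M.zero_closed by (simp only: M.zero_eq C.zero_eq)
  next
    case (neg f)
    then show ?case using M.neg_closed[of f] by (simp only: M.neg_eq C.neg_eq)
  next
    case (oplus f g)
    then show ?case using M.oplus_closed[of f g] by (simp only: M.oplus_eq C.oplus_eq)
  qed
qed

lemma free_function_algebra: "mv_function_algebra (cube n) (free_alg n)"
proof -
  interpret C: mv_function_algebra "cube n" "Cont_alg n" by (rule Cont_function_algebra)
  interpret M: mv_function_algebra "cube n" "McNaughton_alg n" by (rule McNaughton_function_algebra)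
  have "free_alg n = (cube_functions n)\<lparr>carrier := carrier (free_alg n)\<rparr>"
    by (simp add: free_alg_def Cont_alg_def)
  moreover have "mv_function_algebra (cube n) ((cube_functions n)\<lparr>carrier := carrier (free_alg n)\<rparr>)"
  proof (rule mv_function_algebra_cube)
    show "carrier (free_alg n) \<subseteq> cube n \<rightarrow>\<^sub>E {0..1}"
      using free_subset_McNaughton M.carrier_functions by (rule order_trans)
    show "(\<lambda>x\<in>cube n. 0) \<in> carrier (free_alg n)"
      using mv_generated.zero[of "Cont_alg n"] unfolding carrier_free_alg C.zero_eq .
    show "(\<lambda>x\<in>cube n. min 1 (f x + g x)) \<in> carrier (free_alg n)"
      if "f \<in> carrier (free_alg n)" "g \<in> carrier (free_alg n)" for f g
      using mv_generated.oplus[OF that[unfolded carrier_free_alg]] unfolding carrier_free_alg C.oplus_eq .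
    show "(\<lambda>x\<in>cube n. 1 - f x) \<in> carrier (free_alg n)" if "f \<in> carrier (free_alg n)" for f
      using mv_generated.neg[OF that[unfolded carrier_free_alg]] unfolding carrier_free_alg C.neg_eq .
  qed
  ultimately show ?thesis by simp
qed

lemma McNaughton_piecewise_affine:
  assumes "f \<in> carrier (McNaughton_alg n)"
  shows "piecewise_affine n f"
  using assms integral_affine_subset[of n]
  unfolding carrier_McNaughton_alg carrier_Cont_alg piecewise_integral_def piecewise_affine_def by blast

lemma free_strongly_semisimple: "strongly_semisimple_function_algebra (cube n) (free_alg n)"
proof -
  interpret F: mv_function_algebra "cube n" "free_alg n" by (rule free_function_algebra)
  show ?thesis
  proof
    fix a d assume a: "a \<in> carrier (free_alg n)" and d: "d \<in> carrier (free_alg n)"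
      and zeros: "\<And>x. x \<in> cube n \<Longrightarrow> a x = 0 \<Longrightarrow> d x = 0"
    have "piecewise_affine n a" "piecewise_affine n d"
      using a d free_subset_McNaughton McNaughton_piecewise_affine by blast+
    then show "\<exists>m::nat. \<forall>x\<in>cube n. d x \<le> of_nat m * a x"
      by (rule piecewise_affine_dominated) (use F.value_range[OF a] zeros in auto)
  qed
qed

section \<open>Truncated integral affine functions are term functions\<close>

definition truncation :: "nat \<Rightarrow> ((nat \<Rightarrow> real) \<Rightarrow> real) \<Rightarrow> (nat \<Rightarrow> real) \<Rightarrow> real" where
  "truncation n h = (\<lambda>x\<in>cube n. max 0 (min 1 (h x)))"

text \<open>Induction on the sum of the absolute values of the coefficients, for all constant terms
  at once. With \<open>h\<^sup>#\<close> for the truncation and \<open>x\<close> in the unit interval,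
  \<open>(h + x)\<^sup># = (h\<^sup># \<oplus> x) \<ominus> \<not> (h + 1)\<^sup>#\<close> and \<open>(h - x)\<^sup># = (h\<^sup># \<ominus> x) \<oplus> (h - 1)\<^sup>#\<close>. Both identities
  lower one coefficient by one in absolute value.\<close>

lemma truncation_free_aux:
  "(\<Sum>i<n. nat \<bar>s i\<bar>) = k \<Longrightarrow>
    truncation n (\<lambda>x. of_int c + (\<Sum>i<n. of_int (s i) * x i)) \<in> carrier (free_alg n)"
proof (induction k arbitrary: c s rule: less_induct)
  case (less k)
  interpret F: mv_function_algebra "cube n" "free_alg n" by (rule free_function_algebra)
  show ?case
  proof (cases "\<forall>i<n. s i = 0")
    case True
    show ?thesis
    proof (cases "c \<le> 0")
      case True
      then have "truncation n (\<lambda>x. of_int c + (\<Sum>i<n. of_int (s i) * x i)) = mv_zero (free_alg n)"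
        using \<open>\<forall>i<n. s i = 0\<close> by (auto simp: truncation_def F.zero_eq intro!: restrict_ext)
      then show ?thesis using F.zero_closed by simp
    next
      case False
      then have "truncation n (\<lambda>x. of_int c + (\<Sum>i<n. of_int (s i) * x i)) = mv_one (free_alg n)"
        using \<open>\<forall>i<n. s i = 0\<close> by (auto simp: truncation_def F.one_eq intro!: restrict_ext)
      then show ?thesis using F.one_closed by simp
    qed
  next
    case False
    then obtain j where j: "j < n" "s j \<noteq> 0" by blast
    define \<delta> :: int where "\<delta> = sgn (s j)"
    define s' where "s' = s(j := s j - \<delta>)"
    have split: "(\<Sum>i<n. f i) = f j + (\<Sum>i\<in>{..<n} - {j}. f i)" for f :: "nat \<Rightarrow> 'b::comm_monoid_add"
      using j by (intro sum.remove) auto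
    have "(\<Sum>i\<in>{..<n} - {j}. nat \<bar>s' i\<bar>) = (\<Sum>i\<in>{..<n} - {j}. nat \<bar>s i\<bar>)"
      by (intro sum.cong) (auto simp: s'_def)
    moreover have "nat \<bar>s' j\<bar> < nat \<bar>s j\<bar>"
      using j(2) by (auto simp: s'_def \<delta>_def sgn_if)
    ultimately have "(\<Sum>i<n. nat \<bar>s' i\<bar>) < k"
      using less.prems split[of "\<lambda>i. nat \<bar>s i\<bar>"] split[of "\<lambda>i. nat \<bar>s' i\<bar>"] by linarith
    from less.IH[OF this refl] have IH:
      "truncation n (\<lambda>x. of_int c + (\<Sum>i<n. of_int (s' i) * x i)) \<in> carrier (free_alg n)" for c .
    define h where "h x = of_int c + (\<Sum>i<n. of_int (s' i) * x i)" for x :: "nat \<Rightarrow> real"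
    have h_shift: "truncation n (\<lambda>x. h x + of_int e) \<in> carrier (free_alg n)" for e :: int
      using IH[of "c + e"] by (simp add: h_def algebra_simps)
    have rest: "(\<Sum>i\<in>{..<n} - {j}. of_int (s' i) * x i) = (\<Sum>i\<in>{..<n} - {j}. of_int (s i) * x i)"
      for x :: "nat \<Rightarrow> real" by (intro sum.cong) (auto simp: s'_def)
    have target: "(\<lambda>x. of_int c + (\<Sum>i<n. of_int (s i) * x i)) = (\<lambda>x :: nat \<Rightarrow> real. h x + of_int \<delta> * x j)"
    proof
      fix x :: "nat \<Rightarrow> real"
      have "s j = s' j + \<delta>" by (simp add: s'_def)
      then show "of_int c + (\<Sum>i<n. of_int (s i) * x i) = h x + of_int \<delta> * x j"
        unfolding h_def split[of "\<lambda>i. of_int (s i) * x i"] split[of "\<lambda>i. of_int (s' i) * x i"] rest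
        by (simp add: algebra_simps)
    qed
    define X where "X = (\<lambda>x\<in>cube n. x j)"
    have X: "X \<in> carrier (free_alg n)"
      unfolding carrier_free_alg X_def using j by (intro mv_generated.generator) blast
    define u where "u = truncation n h"
    have u: "u \<in> carrier (free_alg n)" using h_shift[of 0] by (simp add: u_def)
    consider "\<delta> = 1" | "\<delta> = -1" using j by (cases "0 < s j") (auto simp: \<delta>_def)
    then show ?thesis
    proof cases
      case 1
      define v where "v = truncation n (\<lambda>x. h x + 1)"
      have v: "v \<in> carrier (free_alg n)" using h_shift[of 1] by (simp add: v_def)
      have "truncation n (\<lambda>x. h x + of_int \<delta> * x j) =
          mv_ominus (free_alg n) (u \<oplus>\<^bsub>free_alg n\<^esub> X) (mv_neg (free_alg n) v)"
        unfolding F.ominus_eq[OF F.oplus_closed[OF u X] F.neg_closed[OF v]] truncation_def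
      proof (intro restrict_ext)
        fix x assume x: "x \<in> cube n"
        then have "x j \<in> {0..1}" using cube_coordinate j(1) by blast
        then show "max 0 (min 1 (h x + of_int \<delta> * x j)) =
            max 0 ((u \<oplus>\<^bsub>free_alg n\<^esub> X) x - mv_neg (free_alg n) v x)"
          using x 1 by (simp add: F.oplus_eq F.neg_eq u_def v_def X_def truncation_def max_def min_def)
      qed
      then show ?thesis
        using F.ominus_closed[OF F.oplus_closed[OF u X] F.neg_closed[OF v]] by (simp add: target)
    next
      case 2
      define v where "v = truncation n (\<lambda>x. h x - 1)"
      have v: "v \<in> carrier (free_alg n)" using h_shift[of "-1"] by (simp add: v_def)
      have "truncation n (\<lambda>x. h x + of_int \<delta> * x j) =
          mv_ominus (free_alg n) u X \<oplus>\<^bsub>free_alg n\<^esub> v"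
        unfolding F.ominus_eq[OF u X] F.oplus_eq truncation_def
      proof (intro restrict_ext)
        fix x assume x: "x \<in> cube n"
        then have "x j \<in> {0..1}" using cube_coordinate j(1) by blast
        then show "max 0 (min 1 (h x + of_int \<delta> * x j)) =
            min 1 ((\<lambda>x\<in>cube n. max 0 (u x - X x)) x + v x)"
          using x 2 by (simp add: u_def v_def X_def truncation_def max_def min_def)
      qed
      then show ?thesis
        using F.oplus_closed[OF F.ominus_closed[OF u X] v] by (simp add: target)
    qed
  qed
qed

lemma truncation_free:
  assumes "h \<in> integral_affine n"
  shows "truncation n h \<in> carrier (free_alg n)"
  using assms truncation_free_aux unfolding integral_affine_def by blast

section \<open>Global sections are McNaughton functions\<close>

text \<open>The pairs \<open>(b, s)\<close> in \<open>D\<close> correspond to the relations \<open>R\<close> comparing any two of the affine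
  pieces of \<open>\<tau>\<close>: \<open>b\<close> generates the ideal of the truncations \<open>T R\<close>, so that its zero set is the
  cell of \<open>R\<close>, and \<open>s\<close> agrees with \<open>\<tau>\<close> on that cell. A prime \<open>P\<close> lies in the open set of the
  relation \<open>R\<close> that \<open>P\<close> itself defines.\<close>

lemma McNaughton_is_section_value:
  assumes \<tau>: "\<tau> \<in> carrier (McNaughton_alg n)"
  shows "\<exists>\<sigma>\<in>carrier (global_sections (free_alg n)).
    \<forall>x\<in>cube n. mv_function_algebra.section_value (free_alg n) \<sigma> x = \<tau> x"
proof -
  interpret F: strongly_semisimple_function_algebra "cube n" "free_alg n"
    by (rule free_strongly_semisimple)
  have range: "0 \<le> \<tau> x \<and> \<tau> x \<le> 1" if "x \<in> cube n" for x
    using \<tau> cube_value_range[OF _ that] by (simp add: carrier_McNaughton_alg carrier_Cont_alg)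
  have cont: "continuous_map (cube_topology n) euclideanreal \<tau>"
    using \<tau> by (simp add: carrier_McNaughton_alg carrier_Cont_alg)
  obtain H where H: "finite H" "H \<subseteq> integral_affine n" "\<forall>x\<in>cube n. \<exists>h\<in>H. \<tau> x = h x"
    using \<tau> unfolding carrier_McNaughton_alg piecewise_integral_def by blast
  have HA: "H \<subseteq> affine_functions n" using H(2) integral_affine_subset by (rule order_trans)
  define T where "T R = (\<lambda>(g, h). truncation n (\<lambda>x. g x - h x)) ` R" for R
  have T_free: "T R \<subseteq> carrier (free_alg n)" if "R \<subseteq> H \<times> H" for R
    unfolding T_def using that H(2) by (force intro!: truncation_free integral_affine_diff)
  define good where "good R \<longleftrightarrow> R \<subseteq> H \<times> H \<and> (\<forall>g\<in>H. \<forall>h\<in>H. (g, h) \<in> R \<or> (h, g) \<in> R)" for R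
  define D where "D = {(b, s). b \<in> carrier (free_alg n) \<and> s \<in> carrier (free_alg n) \<and>
    (\<exists>R. good R \<and> (\<forall>I. mv_ideal (free_alg n) I \<longrightarrow> (b \<in> I \<longleftrightarrow> T R \<subseteq> I)) \<and> (\<forall>x\<in>cell n R. s x = \<tau> x))}"
  have representative: "\<exists>s\<in>carrier (free_alg n). \<forall>x\<in>cell n R. s x = \<tau> x" if R: "good R" for R
  proof (cases "cell n R = {}")
    case True
    then show ?thesis using F.zero_closed by blast
  next
    case False
    have R': "R \<subseteq> H \<times> H" and tot: "\<And>g h. g \<in> H \<Longrightarrow> h \<in> H \<Longrightarrow> (g, h) \<in> R \<or> (h, g) \<in> R"
      using R by (auto simp: good_def)
    have "\<exists>h\<in>H. \<forall>x\<in>cell n R. \<tau> x = h x"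
      by (rule piecewise_affine_on_cell[OF H(1) HA R' tot False cont bspec[OF H(3)]])
    then obtain h where h: "h \<in> H" "\<forall>x\<in>cell n R. \<tau> x = h x" by blast
    have "truncation n h x = \<tau> x" if "x \<in> cell n R" for x
    proof -
      have "x \<in> cube n" using that by (simp add: cell_def)
      then show ?thesis using range[of x] bspec[OF h(2) that] by (simp add: truncation_def)
    qed
    then show ?thesis using truncation_free[of h n] h(1) H(2) by blast
  qed
  show ?thesis
  proof (rule F.section_gluing[of D])
    show "D \<subseteq> carrier (free_alg n) \<times> carrier (free_alg n)" by (auto simp: D_def)
  next
    fix P assume P: "P \<in> Spec (free_alg n)"
    define R where "R = {(g, h) \<in> H \<times> H. truncation n (\<lambda>x. g x - h x) \<in> P}"
    have "(g, h) \<in> R \<or> (h, g) \<in> R" if gh: "g \<in> H" "h \<in> H" for g h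
    proof -
      define u where "u = truncation n (\<lambda>x. g x - h x)"
      define v where "v = truncation n (\<lambda>x. h x - g x)"
      have u: "u \<in> carrier (free_alg n)" and v: "v \<in> carrier (free_alg n)"
        using gh H(2) unfolding u_def v_def by (blast intro: truncation_free integral_affine_diff)+
      \<comment> \<open>At each point one of \<open>u\<close>, \<open>v\<close> vanishes, so primality of \<open>P\<close> forces one of them into \<open>P\<close>.\<close>
      have "mv_ominus (free_alg n) u v = u" "mv_ominus (free_alg n) v u = v"
        unfolding F.ominus_eq[OF u v] F.ominus_eq[OF v u]
        by (auto simp: u_def v_def truncation_def intro!: restrict_ext)
      then have "u \<in> P \<or> v \<in> P" using P u v by (fastforce simp: Spec_def mv_prime_ideal_def)
      then show ?thesis using gh by (auto simp: R_def u_def v_def)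
    qed
    then have R: "good R" by (auto simp: good_def R_def)
    have R': "R \<subseteq> H \<times> H" by (auto simp: R_def)
    then have "finite (T R)" unfolding T_def
      using H(1) by (intro finite_imageI) (meson finite_SigmaI finite_subset)
    from F.finite_ideal_generator[OF this T_free[OF R']] obtain b where b: "b \<in> carrier (free_alg n)"
      "\<forall>I. mv_ideal (free_alg n) I \<longrightarrow> (b \<in> I \<longleftrightarrow> T R \<subseteq> I)" by blast
    obtain s where s: "s \<in> carrier (free_alg n)" "\<forall>x\<in>cell n R. s x = \<tau> x"
      using representative[OF R] by blast
    have "T R \<subseteq> P" by (auto simp: T_def R_def)
    then have "b \<in> P" using b(2) F.Spec_ideal[OF P] by blast
    moreover have "(b, s) \<in> D" unfolding D_def using b s R by blast
    ultimately show "\<exists>(b, s)\<in>D. b \<in> P" by blast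
  next
    fix b s x assume bs: "(b, s) \<in> D" and x: "x \<in> cube n" and bx: "b x = 0"
    obtain R where R: "good R" "\<forall>x\<in>cell n R. s x = \<tau> x" and b: "b \<in> carrier (free_alg n)"
      and gen: "\<forall>I. mv_ideal (free_alg n) I \<longrightarrow> (b \<in> I \<longleftrightarrow> T R \<subseteq> I)"
      using bs unfolding D_def by blast
    have "b \<in> F.point_ideal x" using b bx by (simp add: F.point_ideal_def)
    then have TR: "T R \<subseteq> F.point_ideal x"
      using gen F.Spec_ideal[OF F.point_ideal_in_Spec[OF x]] by blast
    have "g x \<le> h x" if "(g, h) \<in> R" for g h
    proof -
      have "truncation n (\<lambda>x. g x - h x) \<in> T R" unfolding T_def using that by force
      then have "truncation n (\<lambda>x. g x - h x) x = 0" using TR by (auto simp: F.point_ideal_def)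
      then show ?thesis using x by (simp add: truncation_def max_def min_def split: if_splits)
    qed
    then have "x \<in> cell n R" using x by (auto simp: cell_def)
    then show "s x = \<tau> x" using R(2) by blast
  qed
qed

text \<open>By compactness finitely many elements \<open>b\<close> and representatives \<open>s b\<close> describe \<open>\<sigma>\<close>. The
  zero sets of the \<open>b\<close> cover the cube, and the value function is \<open>s b\<close> on the zero set of \<open>b\<close>.\<close>

lemma section_value_McNaughton:
  assumes \<sigma>: "\<sigma> \<in> carrier (global_sections (free_alg n))"
  shows "(\<lambda>x\<in>cube n. mv_function_algebra.section_value (free_alg n) \<sigma> x) \<in> carrier (McNaughton_alg n)"
proof -
  interpret F: mv_function_algebra "cube n" "free_alg n" by (rule free_function_algebra)
  define f where "f = (\<lambda>x\<in>cube n. F.section_value \<sigma> x)"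
  obtain B s where B: "finite B" "B \<subseteq> carrier (free_alg n)"
    and s: "s ` B \<subseteq> carrier (free_alg n)"
    and cover: "\<forall>P\<in>Spec (free_alg n). \<exists>b\<in>B. b \<in> P"
    and \<sigma>s: "\<forall>b\<in>B. \<forall>Q\<in>Spec (free_alg n). b \<in> Q \<longrightarrow> \<sigma> Q = (Q, mv_class (free_alg n) Q (s b))"
    using F.section_finite_cover[OF \<sigma>] by (elim exE conjE) (rule that)
  have M: "b \<in> carrier (McNaughton_alg n)" "s b \<in> carrier (McNaughton_alg n)" if "b \<in> B" for b
    using subsetD[OF free_subset_McNaughton] subsetD[OF B(2) that] subsetD[OF s imageI[OF that]] by blast+
  have value_eq: "f x = s b x" if "x \<in> cube n" "b \<in> B" "b x = 0" for b x
  proof -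
    have "s b \<in> carrier (free_alg n)" "b \<in> carrier (free_alg n)"
      using subsetD[OF B(2) that(2)] subsetD[OF s imageI[OF that(2)]] by simp_all
    then have "F.section_value \<sigma> x = s b x"
      by (rule F.section_value_local[of x "s b" b, OF that(1) _ _ that(3)]) (use \<sigma>s that(2) in blast)
    then show ?thesis using that(1) by (simp add: f_def)
  qed
  have ex: "\<exists>b\<in>B. b x = 0" if "x \<in> cube n" for x
    using bspec[OF cover F.point_ideal_in_Spec[OF that]] unfolding F.point_ideal_def by blast
  have cont: "continuous_map (cube_topology n) euclideanreal g" if "g \<in> carrier (McNaughton_alg n)" for g
    using that by (simp add: carrier_McNaughton_alg carrier_Cont_alg)
  have "continuous_map (cube_topology n) euclideanreal f"
  proof (rule pasting_lemma_closed[OF B(1), where T = "\<lambda>b. {x \<in> cube n. b x = 0}" and f = s])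
    fix b assume b: "b \<in> B"
    show "closedin (cube_topology n) {x \<in> cube n. b x = 0}"
      using closedin_continuous_map_preimage[OF cont[OF M(1)[OF b]], of "{0}"]
      by (simp add: topspace_cube)
    show "continuous_map (subtopology (cube_topology n) {x \<in> cube n. b x = 0}) euclideanreal (s b)"
      by (rule continuous_map_from_subtopology[OF cont[OF M(2)[OF b]]])
  next
    fix b c x assume "b \<in> B" "c \<in> B"
      "x \<in> topspace (cube_topology n) \<inter> {x \<in> cube n. b x = 0} \<inter> {x \<in> cube n. c x = 0}"
    then show "s b x = s c x" using value_eq[of x b] value_eq[of x c] by simp
  next
    fix x assume "x \<in> topspace (cube_topology n)"
    then have x: "x \<in> cube n" by (simp add: topspace_cube)
    obtain b where "b \<in> B" "b x = 0" using ex[OF x] by blast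
    then show "\<exists>b. b \<in> B \<and> x \<in> {x \<in> cube n. b x = 0} \<and> f x = s b x"
      using x value_eq[OF x] by (intro exI[of _ b]) simp
  qed
  moreover have "f \<in> cube n \<rightarrow>\<^sub>E {0..1}"
    using F.section_value_range[OF \<sigma>] unfolding f_def restrict_PiE_iff by blast
  moreover have "piecewise_integral n f"
  proof -
    have "\<forall>b\<in>B. \<exists>H. finite H \<and> H \<subseteq> integral_affine n \<and> (\<forall>x\<in>cube n. \<exists>h\<in>H. s b x = h x)"
      using M(2) by (simp add: carrier_McNaughton_alg piecewise_integral_def)
    then obtain H where H: "\<forall>b\<in>B. finite (H b) \<and> H b \<subseteq> integral_affine n \<and>
        (\<forall>x\<in>cube n. \<exists>h\<in>H b. s b x = h x)" by (rule bchoice[THEN exE])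
    have "\<exists>h\<in>\<Union>(H ` B). f x = h x" if x: "x \<in> cube n" for x
    proof -
      obtain b where b: "b \<in> B" "b x = 0" using ex[OF x] by blast
      then obtain h where "h \<in> H b" "s b x = h x" using bspec[OF H b(1)] x by blast
      then show ?thesis using value_eq[OF x b] b(1) by (intro bexI[of _ h]) auto
    qed
    moreover have "finite (\<Union>(H ` B))" "\<Union>(H ` B) \<subseteq> integral_affine n" using B(1) H by auto
    ultimately show ?thesis unfolding piecewise_integral_def by blast
  qed
  ultimately have "f \<in> carrier (McNaughton_alg n)" by (simp add: carrier_McNaughton_alg carrier_Cont_alg)
  then show ?thesis by (simp only: f_def)
qed

lemma section_function_eq:
  "section_function n \<sigma> = (\<lambda>x\<in>cube n. mv_function_algebra.section_value (free_alg n) \<sigma> x)"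
proof -
  interpret F: mv_function_algebra "cube n" "free_alg n" by (rule free_function_algebra)
  have "mv_kernel (free_alg n) (eval_at n x) = F.point_ideal x" for x
    by (auto simp: mv_kernel_def eval_at_def F.point_ideal_def)
  then show ?thesis by (simp add: section_function_def F.section_value_def)
qed

lemma inj_on_section_function:
  "inj_on (section_function n) (carrier (global_sections (free_alg n)))"
proof (rule inj_onI)
  interpret F: strongly_semisimple_function_algebra "cube n" "free_alg n"
    by (rule free_strongly_semisimple)
  fix \<sigma> \<rho> assume \<sigma>: "\<sigma> \<in> carrier (global_sections (free_alg n))"
    and \<rho>: "\<rho> \<in> carrier (global_sections (free_alg n))"
    and eq: "section_function n \<sigma> = section_function n \<rho>"
  show "\<sigma> = \<rho>"
  proof (rule F.section_value_injective[OF \<sigma> \<rho>])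
    fix x assume "x \<in> cube n"
    then show "F.section_value \<sigma> x = F.section_value \<rho> x"
      using fun_cong[OF eq, of x] by (simp add: section_function_eq)
  qed
qed

lemma section_function_morphism:
  assumes B: "mv_function_algebra (cube n) B" and sub: "carrier (McNaughton_alg n) \<subseteq> carrier B"
  shows "mv_morphism (global_sections (free_alg n)) B (section_function n)"
proof -
  interpret F: strongly_semisimple_function_algebra "cube n" "free_alg n"
    by (rule free_strongly_semisimple)
  interpret B: mv_function_algebra "cube n" B by (rule B)
  show ?thesis
  proof (rule mv_morphism_of_injective_map[OF B.mv_algebra])
    show "inj_on (section_function n) (carrier (global_sections (free_alg n)))"
      by (rule inj_on_section_function)
  next
    fix \<sigma> assume \<sigma>: "\<sigma> \<in> carrier (global_sections (free_alg n))"
    show "section_function n \<sigma> \<in> carrier B"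
      unfolding section_function_eq using section_value_McNaughton[OF \<sigma>] sub by blast
    show "mv_neg (global_sections (free_alg n)) \<sigma> \<in> carrier (global_sections (free_alg n)) \<and>
        section_function n (mv_neg (global_sections (free_alg n)) \<sigma>) = mv_neg B (section_function n \<sigma>)"
      using F.section_neg[OF \<sigma>] by (auto simp: section_function_eq B.neg_eq intro!: restrict_ext)
    fix \<rho> assume \<rho>: "\<rho> \<in> carrier (global_sections (free_alg n))"
    show "\<sigma> \<oplus>\<^bsub>global_sections (free_alg n)\<^esub> \<rho> \<in> carrier (global_sections (free_alg n)) \<and>
        section_function n (\<sigma> \<oplus>\<^bsub>global_sections (free_alg n)\<^esub> \<rho>) =
          section_function n \<sigma> \<oplus>\<^bsub>B\<^esub> section_function n \<rho>"
      using F.section_oplus[OF \<sigma> \<rho>] by (auto simp: section_function_eq B.oplus_eq intro!: restrict_ext)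
  next
    show "mv_zero (global_sections (free_alg n)) \<in> carrier (global_sections (free_alg n)) \<and>
        section_function n (mv_zero (global_sections (free_alg n))) = mv_zero B"
      using F.hat_section[OF F.zero_closed] F.section_value_hat[OF F.zero_closed]
      by (auto simp: F.section_zero section_function_eq B.zero_eq F.zero_eq intro!: restrict_ext)
  qed
qed

theorem theorem9p9:
  fixes n :: nat
  shows "mv_morphism (global_sections (free_alg n)) (Cont_alg n) (section_function n)
    \<and> mv_isomorphism (global_sections (free_alg n)) (McNaughton_alg n) (section_function n)
    \<and> (\<forall>g\<in>carrier (free_alg n).
         hat (free_alg n) g \<in> carrier (global_sections (free_alg n))
         \<and> section_function n (hat (free_alg n) g) = g)"
proof -
  interpret F: strongly_semisimple_function_algebra "cube n" "free_alg n"
    by (rule free_strongly_semisimple)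
  have morphism: "mv_morphism (global_sections (free_alg n)) (Cont_alg n) (section_function n)"
    by (rule section_function_morphism[OF Cont_function_algebra]) (auto simp: carrier_McNaughton_alg)
  have morphism': "mv_morphism (global_sections (free_alg n)) (McNaughton_alg n) (section_function n)"
    by (rule section_function_morphism[OF McNaughton_function_algebra order_refl])
  have ext: "f = (\<lambda>x\<in>cube n. f x)" if "f \<in> carrier (McNaughton_alg n)" for f
    using that PiE_restrict[of f "cube n" "\<lambda>_. {0..1}"]
    by (simp add: carrier_McNaughton_alg carrier_Cont_alg)
  have "bij_betw (section_function n) (carrier (global_sections (free_alg n))) (carrier (McNaughton_alg n))"
    unfolding bij_betw_def
  proof
    show "inj_on (section_function n) (carrier (global_sections (free_alg n)))"
      by (rule inj_on_section_function)
    show "section_function n ` carrier (global_sections (free_alg n)) = carrier (McNaughton_alg n)"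
    proof
      show "section_function n ` carrier (global_sections (free_alg n)) \<subseteq> carrier (McNaughton_alg n)"
        using section_value_McNaughton by (auto simp: section_function_eq)
      show "carrier (McNaughton_alg n) \<subseteq> section_function n ` carrier (global_sections (free_alg n))"
      proof
        fix \<tau> assume \<tau>: "\<tau> \<in> carrier (McNaughton_alg n)"
        obtain \<sigma> where \<sigma>: "\<sigma> \<in> carrier (global_sections (free_alg n))"
          "\<forall>x\<in>cube n. F.section_value \<sigma> x = \<tau> x" using McNaughton_is_section_value[OF \<tau>] by blast
        have "section_function n \<sigma> = (\<lambda>x\<in>cube n. \<tau> x)"
          unfolding section_function_eq using \<sigma>(2) by (intro restrict_ext) blast
        then have "section_function n \<sigma> = \<tau>" using ext[OF \<tau>] by simp
        then show "\<tau> \<in> section_function n ` carrier (global_sections (free_alg n))" using \<sigma>(1) by blast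
      qed
    qed
  qed
  then have isomorphism:
    "mv_isomorphism (global_sections (free_alg n)) (McNaughton_alg n) (section_function n)"
    using morphism' by (simp add: mv_isomorphism_def mv_isomorphism_axioms_def)
  have "hat (free_alg n) g \<in> carrier (global_sections (free_alg n))
      \<and> section_function n (hat (free_alg n) g) = g" if g: "g \<in> carrier (free_alg n)" for g
  proof
    show "hat (free_alg n) g \<in> carrier (global_sections (free_alg n))" by (rule F.hat_section[OF g])
    have "section_function n (hat (free_alg n) g) = (\<lambda>x\<in>cube n. g x)"
      unfolding section_function_eq using F.section_value_hat[OF g] by (intro restrict_ext)
    then show "section_function n (hat (free_alg n) g) = g"
      using ext g free_subset_McNaughton by force
  qed
  with morphism isomorphism show ?thesis by blast
qed

end
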